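(* Let $H$ be a graph, let $L(H)$ be its line graph, let $\mathfrak{C}$ be a Kempe coloring of $L(H)$, and let $T$ be a transversal of $\mathfrak{C}$. Then there exists a complete minor (clique minor) in $L(H)$ that is traversed by $T$.
   Context: All graphs are finite, undirected and loopless; they may contain parallel edges (graphs without parallel edges are called simple). The line graph $L(H)$ of a graph $H$ is the simple graph with vertex set $E(H)$ in which two distinct vertices are adjacent if and only if they are incident as edges of $H$, i.e. they share at least one endvertex in $H$ (so parallel edges of $H$ are adjacent in $L(H)$). Let $G$ be a graph. A set $A \subseteq V(G)$ is connected if the subgraph $G[A]$ induced by $A$ is connected. Disjoint sets $A,B \subseteq V(G)$ are adjacent if some vertex of $A$ is adjacent to some vertex of $B$. A clique minor (also: complete minor) of $G$ is a set of connected, nonempty, pairwise disjoint, pairwise adjacent subsets of $V(G)$, called the branching sets. An anticlique of $G$ is a set of pairwise nonadjacent vertices. A coloring of $G$ is a partition of $V(G)$ into anticliques (the color classes). A Kempe coloring of $G$ is a coloring such that the union of any two (distinct) color classes induces a connected subgraph of $G$. A transversal of a set $\mathfrak{S}$ of pairwise disjoint sets is a set $T \subseteq \bigcup \mathfrak{S}$ such that $|T \cap A| = 1$ for all $A \in \mathfrak{S}$; in this case one also says that $\mathfrak{S}$ is traversed by $T$. (In particular, a clique minor traversed by $T$ has exactly $|T|$ branching sets, each containing exactly one element of $T$, and every element of $T$ lies in a branching set.) *)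

theory Defs
  imports "Graph_Theory.Graph_Theory" "HOL-Library.Disjoint_Sets"
begin

text \<open>
  Finite undirected loopless graphs, possibly with parallel edges. The digraphs of the library
  carry a direction on each arc, so such graphs are introduced here with named edges and a
  two-element set of endvertices for each edge.
\<close>

record ('v, 'e) multigraph =
  vertices :: "'v set"
  edges :: "'e set"
  ends :: "'e \<Rightarrow> 'v set"

locale loopless_multigraph =
  fixes H :: "('v, 'e) multigraph" (structure)
  assumes finite_vertices: "finite (vertices H)"
    and finite_edges: "finite (edges H)"
    and ends_subset: "e \<in> edges H \<Longrightarrow> ends H e \<subseteq> vertices H"
    and card_ends: "e \<in> edges H \<Longrightarrow> card (ends H e) = 2"

text \<open>
  Simple graphs are symmetric loopfree digraphs, as in the library.
\<close>

definition line_graph :: "('v, 'e) multigraph \<Rightarrow> 'e pair_pre_digraph" where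
  "line_graph H =
     \<lparr> pverts = edges H,
       parcs = {(e, f). e \<in> edges H \<and> f \<in> edges H \<and> e \<noteq> f \<and> ends H e \<inter> ends H f \<noteq> {}} \<rparr>"

lemma (in loopless_multigraph) pair_graph_line_graph: "pair_graph (line_graph H)"
proof
  show "finite (pverts (line_graph H))"
    by (simp add: line_graph_def finite_edges)
  have "parcs (line_graph H) \<subseteq> edges H \<times> edges H"
    by (auto simp: line_graph_def)
  then show "finite (parcs (line_graph H))"
    by (rule finite_subset) (simp add: finite_edges)
  show "symmetric (line_graph H)"
    by (auto simp: symmetric_def sym_def arcs_ends_def arc_to_ends_def line_graph_def image_iff)
qed (auto simp: line_graph_def)

text \<open>
  Note that \<^const>\<open>Digraph_Component.connected\<close> is false for the graph without vertices; below it
  is only applied to subgraphs induced by nonempty sets.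
\<close>

definition connected_set :: "('a, 'b) pre_digraph \<Rightarrow> 'a set \<Rightarrow> bool" where
  "connected_set G A \<longleftrightarrow> A \<subseteq> verts G \<and> Digraph_Component.connected (G \<restriction> A)"

definition adjacent_sets :: "('a, 'b) pre_digraph \<Rightarrow> 'a set \<Rightarrow> 'a set \<Rightarrow> bool" where
  "adjacent_sets G A B \<longleftrightarrow> (\<exists>a\<in>A. \<exists>b\<in>B. a \<rightarrow>\<^bsub>G\<^esub> b)"

definition clique_minor :: "('a, 'b) pre_digraph \<Rightarrow> 'a set set \<Rightarrow> bool" where
  "clique_minor G \<BB> \<longleftrightarrow>
     (\<forall>A\<in>\<BB>. A \<noteq> {} \<and> connected_set G A) \<and> disjoint \<BB> \<and> pairwise (adjacent_sets G) \<BB>"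

definition anticlique :: "('a, 'b) pre_digraph \<Rightarrow> 'a set \<Rightarrow> bool" where
  "anticlique G A \<longleftrightarrow> A \<subseteq> verts G \<and> pairwise (\<lambda>a b. \<not> a \<rightarrow>\<^bsub>G\<^esub> b) A"

definition coloring :: "('a, 'b) pre_digraph \<Rightarrow> 'a set set \<Rightarrow> bool" where
  "coloring G \<CC> \<longleftrightarrow> partition_on (verts G) \<CC> \<and> (\<forall>A\<in>\<CC>. anticlique G A)"

definition kempe_coloring :: "('a, 'b) pre_digraph \<Rightarrow> 'a set set \<Rightarrow> bool" where
  "kempe_coloring G \<CC> \<longleftrightarrow> coloring G \<CC> \<and> pairwise (\<lambda>A B. connected_set G (A \<union> B)) \<CC>"

definition transversal :: "'a set set \<Rightarrow> 'a set \<Rightarrow> bool" where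
  "transversal \<SS> T \<longleftrightarrow> T \<subseteq> \<Union>\<SS> \<and> (\<forall>A\<in>\<SS>. card (T \<inter> A) = 1)"

end

theory Submission
  imports Defs
begin

text \<open>
  The colour classes are matchings of \<open>H\<close>, and any two of them form a path or a cycle. Induct on
  the number of edges.

  Suppose that some vertex \<open>v\<close> is incident with every colour. If \<open>T\<close> can be linked to the edges
  at \<open>v\<close> by disjoint paths of \<open>L(H)\<close>, these paths form the minor. Otherwise a minimum
  separator \<open>S\<close> in the sense of Menger misses just one colour and has one edge of every other
  colour, since two missing colours would form a connected set avoiding \<open>S\<close>. Contracting the
  side of \<open>v\<close> to a point then gives a smaller instance, whose minor is lifted along disjoint
  paths from \<open>S\<close> to \<open>v\<close>.

  Suppose that there is no such vertex. Two colour classes cover the same vertices up to two, and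
  from this there is a set \<open>A\<close> such that every colour covers all of \<open>A\<close> but one vertex.
  If \<open>card A = 3\<close>, every class is a single edge, and these edges pairwise meet. Otherwise
  there are no parallel edges, and counting edges shows that \<open>H\<close> is the complete graph on
  \<open>A\<close> with one colour missing at each vertex. There a branching set made of almost two
  colour classes meets everything, and the others are linked to a vertex in the remaining colours.
\<close>

section \<open>Menger's theorem\<close>

text \<open>Walks rather than paths: repetitions are allowed, so gluing never has to avoid them.
  Every element of \<open>A \<inter> B\<close> is by itself such a walk.\<close>

definition path_between :: "'a rel \<Rightarrow> 'a set \<Rightarrow> 'a set \<Rightarrow> 'a list \<Rightarrow> bool" where
  "path_between R A B p \<longleftrightarrow>
     p \<noteq> [] \<and> successively (\<lambda>x y. (x, y) \<in> R) p \<and> hd p \<in> A \<and> last p \<in> B"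

definition separates :: "'a rel \<Rightarrow> 'a set \<Rightarrow> 'a set \<Rightarrow> 'a set \<Rightarrow> bool" where
  "separates R A B S \<longleftrightarrow> (\<forall>p. path_between R A B p \<longrightarrow> set p \<inter> S \<noteq> {})"

lemma path_between_prefix:
  assumes "path_between R A B (ys @ z # zs)" "z \<in> C"
  shows "path_between R A C (ys @ [z])"
  using assms by (auto simp: path_between_def successively_append_iff hd_append)

lemma path_between_suffix:
  assumes "path_between R A B (ys @ z # zs)" "z \<in> C"
  shows "path_between R C B (z # zs)"
  using assms by (auto simp: path_between_def successively_append_iff)

lemma path_between_append:
  assumes "path_between R A B p" "path_between R C D q" "(last p, hd q) \<in> R"
  shows "path_between R A D (p @ q)"
  using assms by (auto simp: path_between_def successively_append_iff)

lemma path_between_join: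
  assumes "path_between R A B (ys @ [z])" "path_between R C D (z # zs)"
  shows "path_between R A D (ys @ z # zs)"
  using assms by (auto simp: path_between_def successively_append_iff hd_append)

lemma path_between_mono:
  assumes "path_between R A B p" "R \<subseteq> R'"
  shows "path_between R' A B p"
  using assms by (auto simp: path_between_def intro: successively_mono)

text \<open>The arc \<open>(x, y)\<close> is used only by leaving \<open>x\<close>, so the walk
  survives the deletion when \<open>x\<close> occurs at most as its last element.\<close>

lemma path_between_delete_tail:
  assumes "path_between R A B (ys @ [z])" "x \<notin> set ys"
  shows "path_between (R - {(x, y)}) A B (ys @ [z])"
proof -
  have "successively (\<lambda>u w. (u, w) \<in> R - {(x, y)}) ys"
    by (rule successively_mono[where P = "\<lambda>u w. (u, w) \<in> R"])
      (use assms in \<open>auto simp: path_between_def successively_append_iff\<close>)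
  then show ?thesis
    using assms by (auto simp: path_between_def successively_append_iff dest: last_in_set)
qed

lemma path_between_delete_head:
  assumes "path_between R A B (z # zs)" "y \<notin> set zs"
  shows "path_between (R - {(x, y)}) A B (z # zs)"
proof -
  have "successively (\<lambda>u w. (u, w) \<in> R - {(x, y)}) zs"
    by (rule successively_mono[where P = "\<lambda>u w. (u, w) \<in> R"])
      (use assms in \<open>auto simp: path_between_def successively_Cons\<close>)
  then show ?thesis
    using assms by (auto simp: path_between_def successively_Cons dest: hd_in_set)
qed

text \<open>
  The induction deletes an arc \<open>(x, y)\<close>. If a set \<open>S\<close> with fewer than \<open>k\<close> elements
  separates \<open>A\<close> from \<open>B\<close> afterwards, then \<open>insert x S\<close> and \<open>insert y S\<close> are separators of size
  \<open>k\<close>, and the paths from \<open>A\<close> to the first meet those from the second to \<open>B\<close> only in \<open>S\<close>.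
\<close>

theorem menger:
  fixes R :: "'a rel"
  assumes "finite R" "finite A" "finite B"
    and "\<And>S. finite S \<Longrightarrow> separates R A B S \<Longrightarrow> k \<le> card S"
  shows "\<exists>\<P>. finite \<P> \<and> card \<P> = k \<and> (\<forall>p\<in>\<P>. path_between R A B p) \<and>
           (\<forall>p\<in>\<P>. \<forall>q\<in>\<P>. p \<noteq> q \<longrightarrow> set p \<inter> set q = {})"
  using assms
proof (induction R arbitrary: A B rule: finite_induct)
  case empty
  \<comment> \<open>Without arcs every walk has a single element.\<close>
  have "separates {} A B (A \<inter> B)"
    unfolding separates_def
  proof (intro allI impI)
    fix p assume "path_between {} A B p"
    then show "set p \<inter> (A \<inter> B) \<noteq> {}"
      by (cases p) (auto simp: path_between_def successively_Cons split: if_splits)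
  qed
  then have "k \<le> card (A \<inter> B)" using empty by simp
  then obtain Z where Z: "Z \<subseteq> A \<inter> B" "card Z = k" "finite Z"
    by (metis obtain_subset_with_card_n)
  have "card ((\<lambda>z. [z]) ` Z) = k"
    using Z by (subst card_image) (auto simp: inj_on_def)
  then show ?case
    using Z by (intro exI[of _ "(\<lambda>z. [z]) ` Z"]) (auto simp: path_between_def)
next
  case (insert e R)
  obtain x y where e: "e = (x, y)" by (cases e)
  let ?G = "insert e R"
  have R: "R = ?G - {(x, y)}" using insert.hyps e by auto
  show ?case
  proof (cases "\<forall>S. finite S \<longrightarrow> separates R A B S \<longrightarrow> k \<le> card S")
    case True
    then obtain \<P> where "finite \<P>" "card \<P> = k" "\<forall>p\<in>\<P>. path_between R A B p"
      "\<forall>p\<in>\<P>. \<forall>q\<in>\<P>. p \<noteq> q \<longrightarrow> set p \<inter> set q = {}"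
      using insert.IH[OF insert.prems(1,2)] by blast
    then show ?thesis
      by (intro exI[of _ \<P>]) (auto intro: path_between_mono)
  next
    case False
    then obtain S where S: "finite S" "separates R A B S" "card S < k" by force
    \<comment> \<open>A walk that avoids \<open>S\<close> must use the deleted arc, so it passes
      through both \<open>x\<close> and \<open>y\<close>.\<close>
    have cross: "x \<in> set p \<and> y \<in> set p" if "path_between ?G A B p" "set p \<inter> S = {}" for p
    proof (rule ccontr)
      assume *: "\<not> ?thesis"
      have "successively (\<lambda>u w. (u, w) \<in> R) p"
        by (rule successively_mono[where P = "\<lambda>u w. (u, w) \<in> ?G"])
          (use * that e in \<open>auto simp: path_between_def\<close>)
      then have "path_between R A B p" using that by (auto simp: path_between_def)
      then show False using S that by (auto simp: separates_def)
    qed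
    have sepx: "separates ?G A B (insert x S)" and sepy: "separates ?G A B (insert y S)"
      using cross by (auto simp: separates_def)
    have kx: "k \<le> card (insert x S)" and ky: "k \<le> card (insert y S)"
      using insert.prems(3)[OF _ sepx] insert.prems(3)[OF _ sepy] S(1) by auto
    have x: "x \<notin> S" and y: "y \<notin> S" and k: "k = Suc (card S)"
      using kx ky S by (auto simp: card_insert_if split: if_splits)
    have cardx: "card (insert x S) = k" and cardy: "card (insert y S) = k"
      using x y k S(1) by auto
    \<comment> \<open>Cut a walk from \<open>A\<close> to \<open>B\<close> at its first visit to
      \<open>insert x S\<close>. Up to there it never leaves \<open>x\<close>, so it is a walk in
      \<open>R\<close> and is met by \<open>Z\<close>.\<close>
    have 1: "k \<le> card Z" if Z: "finite Z" "separates R A (insert x S) Z" for Z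
    proof (rule insert.prems(3)[OF Z(1)])
      show "separates ?G A B Z"
        unfolding separates_def
      proof (intro allI impI)
        fix p assume p: "path_between ?G A B p"
        then obtain ys z zs where "p = ys @ z # zs" "z \<in> insert x S" "set ys \<inter> insert x S = {}"
          using sepx split_list_first_prop[of p "\<lambda>z. z \<in> insert x S"]
          unfolding separates_def by blast
        then have "path_between R A (insert x S) (ys @ [z])"
          using path_between_delete_tail[OF path_between_prefix, of ?G A B ys z zs "insert x S" x y] R p
          by auto
        then show "set p \<inter> Z \<noteq> {}"
          using Z \<open>p = _\<close> by (fastforce simp: separates_def)
      qed
    qed
    \<comment> \<open>Symmetric: after its last visit to \<open>insert y S\<close> a walk never
      enters \<open>y\<close>.\<close>
    have 2: "k \<le> card Z" if Z: "finite Z" "separates R (insert y S) B Z" for Z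
    proof (rule insert.prems(3)[OF Z(1)])
      show "separates ?G A B Z"
        unfolding separates_def
      proof (intro allI impI)
        fix p assume p: "path_between ?G A B p"
        then obtain ys z zs where "p = ys @ z # zs" "z \<in> insert y S" "set zs \<inter> insert y S = {}"
          using sepy split_list_last_prop[of p "\<lambda>z. z \<in> insert y S"]
          unfolding separates_def by blast
        then have "path_between R (insert y S) B (z # zs)"
          using path_between_delete_head[OF path_between_suffix, of ?G A B ys z zs "insert y S" y x] R p
          by auto
        then show "set p \<inter> Z \<noteq> {}"
          using Z \<open>p = _\<close> by (fastforce simp: separates_def)
      qed
    qed
    obtain \<P> where \<P>: "finite \<P>" "card \<P> = k" "\<forall>p\<in>\<P>. path_between R A (insert x S) p"
      "\<forall>p\<in>\<P>. \<forall>q\<in>\<P>. p \<noteq> q \<longrightarrow> set p \<inter> set q = {}"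
      using insert.IH[of A "insert x S", OF insert.prems(1) _ 1] S(1) by auto
    obtain \<Q> where \<Q>: "finite \<Q>" "card \<Q> = k" "\<forall>p\<in>\<Q>. path_between R (insert y S) B p"
      "\<forall>p\<in>\<Q>. \<forall>q\<in>\<Q>. p \<noteq> q \<longrightarrow> set p \<inter> set q = {}"
      using insert.IH[of "insert y S" B, OF _ insert.prems(2) 2] S(1) by auto
    \<comment> \<open>Disjoint walks have different last elements, and there are as many walks as
      elements of \<open>insert x S\<close>. Hence each of these elements ends exactly one
      walk.\<close>
    have "inj_on last \<P>"
    proof (rule inj_onI, rule ccontr)
      fix p q assume "p \<in> \<P>" "q \<in> \<P>" "last p = last q" "p \<noteq> q"
      moreover have "p \<noteq> []" "q \<noteq> []"
        using \<P>(3) \<open>p \<in> \<P>\<close> \<open>q \<in> \<P>\<close> unfolding path_between_def by blast+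
      ultimately have "last p \<in> set p \<inter> set q" by (metis Int_iff last_in_set)
      then show False using \<P>(4) \<open>p \<in> \<P>\<close> \<open>q \<in> \<P>\<close> \<open>p \<noteq> q\<close> by blast
    qed
    then have "card (last ` \<P>) = card (insert x S)" using \<P>(2) cardx by (simp add: card_image)
    moreover have "last ` \<P> \<subseteq> insert x S" using \<P>(3) unfolding path_between_def by blast
    ultimately have "last ` \<P> = insert x S" using S(1) by (simp add: card_subset_eq)
    then have "\<forall>s\<in>insert x S. \<exists>p. p \<in> \<P> \<and> last p = s" by (metis imageE)
    then obtain P where P: "\<And>s. s \<in> insert x S \<Longrightarrow> P s \<in> \<P> \<and> last (P s) = s"
      using bchoice by metis
    have "inj_on hd \<Q>"
    proof (rule inj_onI, rule ccontr)
      fix p q assume "p \<in> \<Q>" "q \<in> \<Q>" "hd p = hd q" "p \<noteq> q"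
      moreover have "p \<noteq> []" "q \<noteq> []"
        using \<Q>(3) \<open>p \<in> \<Q>\<close> \<open>q \<in> \<Q>\<close> unfolding path_between_def by blast+
      ultimately have "hd p \<in> set p \<inter> set q" by (metis Int_iff hd_in_set)
      then show False using \<Q>(4) \<open>p \<in> \<Q>\<close> \<open>q \<in> \<Q>\<close> \<open>p \<noteq> q\<close> by blast
    qed
    then have "card (hd ` \<Q>) = card (insert y S)" using \<Q>(2) cardy by (simp add: card_image)
    moreover have "hd ` \<Q> \<subseteq> insert y S" using \<Q>(3) unfolding path_between_def by blast
    ultimately have "hd ` \<Q> = insert y S" using S(1) by (simp add: card_subset_eq)
    then have "\<forall>s\<in>insert y S. \<exists>p. p \<in> \<Q> \<and> hd p = s" by (metis imageE)
    then obtain Q where Q: "\<And>s. s \<in> insert y S \<Longrightarrow> Q s \<in> \<Q> \<and> hd (Q s) = s"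
      using bchoice by metis
    have Pdisj: "set (P s) \<inter> set (P t) = {}" if "s \<in> insert x S" "t \<in> insert x S" "s \<noteq> t" for s t
      using P[OF that(1)] P[OF that(2)] that \<P>(4) by metis
    have Qdisj: "set (Q s) \<inter> set (Q t) = {}" if "s \<in> insert y S" "t \<in> insert y S" "s \<noteq> t" for s t
      using Q[OF that(1)] Q[OF that(2)] that \<Q>(4) by metis
    have Ppath: "path_between R A (insert x S) (P s)" "s \<in> set (P s)" if "s \<in> insert x S" for s
      using P[OF that] \<P>(3) last_in_set[of "P s"] by (auto simp: path_between_def)
    have Qpath: "path_between R (insert y S) B (Q s)" "s \<in> set (Q s)" if "s \<in> insert y S" for s
      using Q[OF that] \<Q>(3) hd_in_set[of "Q s"] by (auto simp: path_between_def)
    \<comment> \<open>Each walk is trimmed at the first visit to its own end. The other elements of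
      \<open>insert x S\<close> lie on other walks, so afterwards only the end belongs to this
      set.\<close>
    have "\<exists>ys. path_between R A (insert x S) (ys @ [s]) \<and> set (ys @ [s]) \<subseteq> set (P s) \<and>
            set ys \<inter> insert x S = {}" if s: "s \<in> insert x S" for s
    proof -
      obtain ys zs where *: "P s = ys @ s # zs" "s \<notin> set ys"
        using split_list_first[OF Ppath(2)[OF s]] by blast
      moreover have "set ys \<inter> insert x S = {}"
        using Pdisj[OF s] Ppath(2) * by fastforce
      ultimately show ?thesis
        using path_between_prefix[of R A "insert x S" ys s zs] Ppath(1)[OF s] s
        by (intro exI[of _ ys]) auto
    qed
    then obtain p where p: "\<And>s. s \<in> insert x S \<Longrightarrow> path_between R A (insert x S) (p s @ [s]) \<and>
        set (p s @ [s]) \<subseteq> set (P s) \<and> set (p s) \<inter> insert x S = {}"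
      by metis
    have "\<exists>zs. path_between R (insert y S) B (s # zs) \<and> set (s # zs) \<subseteq> set (Q s) \<and>
            set zs \<inter> insert y S = {}" if s: "s \<in> insert y S" for s
    proof -
      obtain ys zs where *: "Q s = ys @ s # zs" "s \<notin> set zs"
        using split_list_last[OF Qpath(2)[OF s]] by blast
      moreover have "set zs \<inter> insert y S = {}"
        using Qdisj[OF s] Qpath(2) * by fastforce
      ultimately show ?thesis
        using path_between_suffix[of R "insert y S" B ys s zs "insert y S"] Qpath(1)[OF s] s
        by (intro exI[of _ zs]) auto
    qed
    then obtain q where q: "\<And>s. s \<in> insert y S \<Longrightarrow> path_between R (insert y S) B (s # q s) \<and>
        set (s # q s) \<subseteq> set (Q s) \<and> set (q s) \<inter> insert y S = {}"
      by metis
    \<comment> \<open>A common element outside \<open>S\<close> would join an initial piece of one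
      walk to a final piece of the other, giving a walk in \<open>R\<close> from \<open>A\<close> to
      \<open>B\<close> that avoids \<open>S\<close>.\<close>
    have meet: "z \<in> S" if z: "z \<in> set (p s @ [s])" "z \<in> set (t # q t)"
      and s: "s \<in> insert x S" and t: "t \<in> insert y S" for s t z
    proof (rule ccontr)
      assume "z \<notin> S"
      obtain as bs where as: "p s @ [s] = as @ z # bs" using z(1) by (meson split_list)
      obtain cs ds where cs: "t # q t = cs @ z # ds" using z(2) by (meson split_list)
      have "set as \<subseteq> set (p s)" using as by (cases bs rule: rev_cases) auto
      moreover have "set ds \<subseteq> set (q t)" using cs by (cases cs) auto
      moreover have "path_between R A B (as @ z # ds)"
        using path_between_join[OF path_between_prefix[of R A "insert x S" as z bs UNIV]
            path_between_suffix[of R "insert y S" B cs z ds UNIV]] p[OF s] q[OF t] as cs by simp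
      ultimately show False
        using S(2) p[OF s] q[OF t] \<open>z \<notin> S\<close> unfolding separates_def by fastforce
    qed
    have pdisj: "set (p s @ [s]) \<inter> set (p t @ [t]) = {}"
      if "s \<in> insert x S" "t \<in> insert x S" "s \<noteq> t" for s t
      using p[OF that(1)] p[OF that(2)] Pdisj[OF that] by blast
    have qdisj: "set (s # q s) \<inter> set (t # q t) = {}"
      if "s \<in> insert y S" "t \<in> insert y S" "s \<noteq> t" for s t
      using q[OF that(1)] q[OF that(2)] Qdisj[OF that] by blast
    \<comment> \<open>Two halves are glued at their common element of \<open>S\<close>; the halves
      belonging to \<open>x\<close> and \<open>y\<close> are joined by the deleted arc. Below,
      \<open>\<phi> s\<close> is the start of the second half of \<open>r s\<close>.\<close>
    define r where "r s = (if s = x then p x @ [x] @ y # q y else p s @ s # q s)" for s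
    have rpath: "path_between ?G A B (r s)" if "s \<in> insert x S" for s
    proof (cases "s = x")
      case True
      have "path_between ?G A B ((p x @ [x]) @ (y # q y))"
        by (rule path_between_append[of _ _ "insert x S" _ "insert y S"])
          (use p[of x] q[of y] e in \<open>auto intro: path_between_mono[of R]\<close>)
      then show ?thesis using True by (simp add: r_def)
    next
      case False
      then have "s \<in> insert y S" using that by simp
      then have "path_between R A B (p s @ s # q s)"
        by (rule path_between_join[OF conjunct1[OF p[OF that]] conjunct1[OF q]])
      then show ?thesis using False by (auto simp: r_def intro: path_between_mono[of R])
    qed
    define \<phi> where "\<phi> s = (if s = x then y else s)" for s
    have \<phi>: "\<phi> s \<in> insert y S" "\<phi> s \<in> S \<Longrightarrow> \<phi> s = s" "\<phi> s = \<phi> t \<Longrightarrow> t \<in> insert x S \<Longrightarrow> s = t"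
      if "s \<in> insert x S" for s t
      using that x y by (auto simp: \<phi>_def split: if_splits)
    have rset: "set (r s) = set (p s @ [s]) \<union> set (\<phi> s # q (\<phi> s))" for s
      by (auto simp: r_def \<phi>_def)
    have pS: "z = s" if "z \<in> set (p s @ [s])" "z \<in> S" "s \<in> insert x S" for z s
      using p[of s] that by auto
    have qS: "z = \<phi> s" if "z \<in> set (\<phi> s # q (\<phi> s))" "z \<in> S" "s \<in> insert x S" for z s
      using q[of "\<phi> s"] \<phi>[of s] that by auto
    have cross_disj: "set (p s @ [s]) \<inter> set (\<phi> t # q (\<phi> t)) = {}"
      if st: "s \<in> insert x S" "t \<in> insert x S" "s \<noteq> t" for s t
    proof (rule ccontr)
      assume "\<not> ?thesis"
      then obtain z where z: "z \<in> set (p s @ [s])" "z \<in> set (\<phi> t # q (\<phi> t))" by blast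
      have "z \<in> S" using meet[OF z st(1)] \<phi>(1)[OF st(2)] by blast
      then show False using pS[OF z(1) _ st(1)] qS[OF z(2) _ st(2)] \<phi>(2)[OF st(2)] st(3) by auto
    qed
    have rdisj: "set (r s) \<inter> set (r t) = {}" if st: "s \<in> insert x S" "t \<in> insert x S" "s \<noteq> t" for s t
    proof -
      have "\<phi> s \<noteq> \<phi> t" using \<phi>(3)[OF st(1) _ st(2)] st(3) by blast
      then have "set (\<phi> s # q (\<phi> s)) \<inter> set (\<phi> t # q (\<phi> t)) = {}"
        using qdisj \<phi>(1) st by blast
      then show ?thesis
        using pdisj[OF st] cross_disj[OF st] cross_disj[OF st(2,1)] st(3)
        unfolding rset by blast
    qed
    have "inj_on r (insert x S)"
    proof (rule inj_onI, rule ccontr)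
      fix s t assume "s \<in> insert x S" "t \<in> insert x S" "r s = r t" "s \<noteq> t"
      then show False using rdisj[of s t] rset[of s] by simp
    qed
    then have "card (r ` insert x S) = k" using cardx by (simp only: card_image)
    then show ?thesis
      using rpath rdisj S(1) by (intro exI[of _ "r ` insert x S"]) blast
  qed
qed

section \<open>Connected edge sets and linkings\<close>

text \<open>Connectedness as the absence of a nonempty proper subset closed under incidence, so that
  proofs need no walks. The empty set counts as connected.\<close>

definition edge_connected :: "('e \<Rightarrow> 'v set) \<Rightarrow> 'e set \<Rightarrow> bool" where
  "edge_connected inc X \<longleftrightarrow>
     (\<forall>C\<subseteq>X. C \<noteq> {} \<longrightarrow> (\<forall>e\<in>C. \<forall>f\<in>X. inc e \<inter> inc f \<noteq> {} \<longrightarrow> f \<in> C) \<longrightarrow> C = X)"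

lemma edge_connectedI:
  assumes "\<And>C. C \<subseteq> X \<Longrightarrow> C \<noteq> {} \<Longrightarrow>
    (\<And>e f. e \<in> C \<Longrightarrow> f \<in> X \<Longrightarrow> inc e \<inter> inc f \<noteq> {} \<Longrightarrow> f \<in> C) \<Longrightarrow> X \<subseteq> C"
  shows "edge_connected inc X"
  using assms unfolding edge_connected_def by (metis subset_antisym)

text \<open>An induction principle: \<open>C\<close> may stick out of \<open>X\<close>, since the
  definition is applied to \<open>C \<inter> X\<close>.\<close>

lemma edge_connectedD:
  assumes "edge_connected inc X" "x \<in> X" "x \<in> C" "f \<in> X"
    and "\<And>e f. e \<in> C \<Longrightarrow> e \<in> X \<Longrightarrow> f \<in> X \<Longrightarrow> inc e \<inter> inc f \<noteq> {} \<Longrightarrow> f \<in> C"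
  shows "f \<in> C"
proof -
  have "C \<inter> X = X"
    using assms(1)[unfolded edge_connected_def, rule_format, of "C \<inter> X"] assms(2,3,5) by blast
  then show ?thesis using assms(4) by blast
qed

lemma edge_connected_singleton: "edge_connected inc {e}"
  by (auto simp: edge_connected_def)

lemma edge_connected_insert:
  assumes "edge_connected inc X" "g \<in> X" "inc f \<inter> inc g \<noteq> {}"
  shows "edge_connected inc (insert f X)"
proof (rule edge_connectedI)
  fix C assume C: "C \<subseteq> insert f X" "C \<noteq> {}"
    and closed: "\<And>e f'. e \<in> C \<Longrightarrow> f' \<in> insert f X \<Longrightarrow> inc e \<inter> inc f' \<noteq> {} \<Longrightarrow> f' \<in> C"
  obtain x where x: "x \<in> C" "x \<in> X"
    using C closed[of f g] assms(2,3) by blast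
  have "X \<subseteq> C" using edge_connectedD[OF assms(1) x(2,1)] closed by blast
  then show "insert f X \<subseteq> C" using assms closed[of g f] by blast
qed

lemma edge_connected_path:
  assumes "successively (\<lambda>e f. inc e \<inter> inc f \<noteq> {}) p"
  shows "edge_connected inc (set p)"
  using assms
proof (induction p rule: induct_list012)
  case (3 x y zs)
  then show ?case using edge_connected_insert[of inc "set (y # zs)" y x] by simp
qed (auto simp: edge_connected_def)

text \<open>Menger's theorem with incident edges of \<open>E\<close> joined by arcs. In the second
  case \<open>R\<close> consists of the edges that still reach \<open>Y\<close> while avoiding
  \<open>S\<close>, whence its closure outside \<open>S\<close>; the later separator arguments use
  only this side.\<close>

lemma linking:
  fixes inc :: "'e \<Rightarrow> 'v set"
  assumes "finite E" "X \<subseteq> E" "Y \<subseteq> E"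
  obtains (linked) P where
    "\<And>x. x \<in> X \<Longrightarrow> x \<in> P x \<and> P x \<subseteq> E \<and> edge_connected inc (P x) \<and> P x \<inter> Y \<noteq> {}"
    "\<And>x x'. x \<in> X \<Longrightarrow> x' \<in> X \<Longrightarrow> x \<noteq> x' \<Longrightarrow> P x \<inter> P x' = {}"
  | (separated) S R where
    "S \<subseteq> E" "card S < card X" "R \<subseteq> E - S" "Y \<subseteq> R \<union> S" "X \<inter> R = {}"
    "\<And>e f. e \<in> R \<Longrightarrow> f \<in> E - S \<Longrightarrow> inc e \<inter> inc f \<noteq> {} \<Longrightarrow> f \<in> R"
proof -
  define A where "A = {(e, f). e \<in> E \<and> f \<in> E \<and> inc e \<inter> inc f \<noteq> {}}"
  have "A \<subseteq> E \<times> E" by (auto simp: A_def)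
  then have finA: "finite A" using assms(1) finite_subset by blast
  have finX: "finite X" and finY: "finite Y" using assms finite_subset by blast+
  show thesis
  proof (cases "\<forall>S. finite S \<longrightarrow> separates A X Y S \<longrightarrow> card X \<le> card S")
    case True
    then obtain \<P> where \<P>: "finite \<P>" "card \<P> = card X" "\<forall>p\<in>\<P>. path_between A X Y p"
      "\<forall>p\<in>\<P>. \<forall>q\<in>\<P>. p \<noteq> q \<longrightarrow> set p \<inter> set q = {}"
      using menger[OF finA finX finY, of "card X"] by blast
    have "inj_on hd \<P>"
    proof (rule inj_onI, rule ccontr)
      fix p q assume *: "p \<in> \<P>" "q \<in> \<P>" "hd p = hd q" "p \<noteq> q"
      then have "p \<noteq> []" "q \<noteq> []" using \<P>(3) unfolding path_between_def by blast+
      then have "hd p \<in> set p \<inter> set q" using *(3) by (metis Int_iff hd_in_set)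
      then show False using \<P>(4) * by blast
    qed
    then have "card (hd ` \<P>) = card X" using \<P>(2) by (simp add: card_image)
    moreover have "hd ` \<P> \<subseteq> X" using \<P>(3) unfolding path_between_def by blast
    ultimately have "hd ` \<P> = X" using finX by (simp add: card_subset_eq)
    then have "\<forall>x\<in>X. \<exists>p. p \<in> \<P> \<and> hd p = x" by (metis imageE)
    then obtain p where p: "\<And>x. x \<in> X \<Longrightarrow> p x \<in> \<P> \<and> hd (p x) = x"
      using bchoice by metis
    have in_E: "set q \<subseteq> E" if "successively (\<lambda>e f. (e, f) \<in> A) q" "q \<noteq> []" "hd q \<in> E" for q
      using that by (induction q rule: induct_list012) (auto simp: A_def)
    show thesis
    proof (rule linked)
      fix x assume x: "x \<in> X"
      then have q: "path_between A X Y (p x)" "hd (p x) = x" using p \<P>(3) by blast+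
      then have "successively (\<lambda>e f. inc e \<inter> inc f \<noteq> {}) (p x)"
        by (auto simp: path_between_def A_def intro: successively_mono)
      moreover have "x \<in> set (p x)" "last (p x) \<in> set (p x)"
        using q hd_in_set[of "p x"] last_in_set[of "p x"] by (auto simp: path_between_def)
      ultimately show "x \<in> set (p x) \<and> set (p x) \<subseteq> E \<and> edge_connected inc (set (p x)) \<and> set (p x) \<inter> Y \<noteq> {}"
        using edge_connected_path[of inc "p x"] q in_E[of "p x"] x assms(2)
        unfolding path_between_def by blast
    next
      fix x x' assume "x \<in> X" "x' \<in> X" "x \<noteq> x'"
      then show "set (p x) \<inter> set (p x') = {}" using p \<P>(4) by metis
    qed
  next
    case False
    then obtain S where S: "finite S" "separates A X Y S" "card S < card X" by force
    define R where "R = {e \<in> E - S. \<exists>p. path_between A {e} Y p \<and> set p \<inter> S = {}}"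
    show thesis
    \<comment> \<open>A separator may contain elements outside \<open>E\<close>; these lie on none
      of the relevant walks and are dropped.\<close>
    proof (rule separated[of "S \<inter> E" R])
      show "card (S \<inter> E) < card X"
        using S card_mono[of S "S \<inter> E"] by auto
      show "Y \<subseteq> R \<union> S \<inter> E"
      proof
        fix y assume "y \<in> Y"
        then have "path_between A {y} Y [y]" by (simp add: path_between_def)
        then show "y \<in> R \<union> S \<inter> E" using \<open>y \<in> Y\<close> assms(3) by (force simp: R_def)
      qed
      show "X \<inter> R = {}"
        using S(2) by (fastforce simp: R_def separates_def path_between_def)
      fix e f assume *: "e \<in> R" "f \<in> E - S \<inter> E" "inc e \<inter> inc f \<noteq> {}"
      then obtain p where p: "path_between A {e} Y p" "set p \<inter> S = {}" by (auto simp: R_def)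
      then have "path_between A {f} Y (f # p)"
        using * by (auto simp: path_between_def successively_Cons A_def R_def)
      then show "f \<in> R"
        using p * by (auto simp: R_def intro!: exI[of _ "f # p"])
    qed (auto simp: R_def)
  qed
qed

section \<open>Rooted minors and Kempe colourings in terms of incidence\<close>

definition rooted_minor :: "('e \<Rightarrow> 'v set) \<Rightarrow> 'e set \<Rightarrow> 'e set \<Rightarrow> ('e \<Rightarrow> 'e set) \<Rightarrow> bool" where
  "rooted_minor inc E T B \<longleftrightarrow>
     (\<forall>t\<in>T. t \<in> B t \<and> B t \<subseteq> E \<and> edge_connected inc (B t)) \<and>
     (\<forall>s\<in>T. \<forall>t\<in>T. s \<noteq> t \<longrightarrow> B s \<inter> B t = {} \<and> (\<exists>e\<in>B s. \<exists>f\<in>B t. inc e \<inter> inc f \<noteq> {}))"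

text \<open>Each colour is named by the element of the transversal \<open>T\<close> that has it.\<close>

locale kempe_graph =
  fixes E :: "'e set" and inc :: "'e \<Rightarrow> 'v set" and col :: "'e \<Rightarrow> 'e" and T :: "'e set"
  assumes finite_E: "finite E"
    and card_inc: "e \<in> E \<Longrightarrow> card (inc e) = 2"
    and T_subset: "T \<subseteq> E"
    and col_T: "t \<in> T \<Longrightarrow> col t = t"
    and col_in_T: "e \<in> E \<Longrightarrow> col e \<in> T"
    and proper: "e \<in> E \<Longrightarrow> f \<in> E \<Longrightarrow> e \<noteq> f \<Longrightarrow> col e = col f \<Longrightarrow> inc e \<inter> inc f = {}"
    and kempe: "s \<in> T \<Longrightarrow> t \<in> T \<Longrightarrow> s \<noteq> t \<Longrightarrow> edge_connected inc {e \<in> E. col e = s \<or> col e = t}"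
begin

definition covered :: "'e \<Rightarrow> 'v \<Rightarrow> bool" where
  "covered t v \<longleftrightarrow> (\<exists>e\<in>E. col e = t \<and> v \<in> inc e)"

lemma finite_T: "finite T"
  using T_subset finite_E finite_subset by blast

text \<open>The form in which the Kempe condition is used: a set that contains one edge of the two
  colours and absorbs all incident edges of these colours contains both classes.\<close>

lemma kempe_class_subset:
  assumes "s \<in> T" "t \<in> T" "s \<noteq> t" "x \<in> E" "col x = s \<or> col x = t" "x \<in> C"
    and "\<And>e f. e \<in> C \<Longrightarrow> e \<in> E \<Longrightarrow> f \<in> E \<Longrightarrow> col f = s \<or> col f = t \<Longrightarrow> inc e \<inter> inc f \<noteq> {} \<Longrightarrow> f \<in> C"
    and "f \<in> E" "col f = s \<or> col f = t"
  shows "f \<in> C"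
  using edge_connectedD[OF kempe[OF assms(1-3)], of x C f] assms(4-) by blast

text \<open>If two colours were missing in \<open>S\<close>, their Kempe chain could not leave
  \<open>R\<close>: it enters \<open>R\<close> at \<open>v\<close> and would carry an element of
  \<open>T\<close> into \<open>R\<close>. So at most one colour is missing, and
  \<open>card S < card T\<close> forces exactly one edge of every other colour.\<close>

lemma separator_colours:
  assumes full: "\<And>t. t \<in> T \<Longrightarrow> covered t v"
    and S: "S \<subseteq> E" "card S < card T"
    and R: "R \<subseteq> E - S" "{e \<in> E. v \<in> inc e} \<subseteq> R \<union> S" "T \<inter> R = {}"
    and closed: "\<And>e f. e \<in> R \<Longrightarrow> f \<in> E - S \<Longrightarrow> inc e \<inter> inc f \<noteq> {} \<Longrightarrow> f \<in> R"
  obtains c where "c \<in> T" "inj_on col S" "col ` S = T - {c}"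
proof -
  have finS: "finite S" using S finite_E finite_subset by blast
  have one: "c = d" if c: "c \<in> T" "c \<notin> col ` S" and d: "d \<in> T" "d \<notin> col ` S" for c d
  proof (rule ccontr)
    assume "c \<noteq> d"
    obtain y where y: "y \<in> E" "col y = c" "v \<in> inc y"
      using full[OF c(1)] by (auto simp: covered_def)
    have "y \<in> R" using y R(2) c(2) by blast
    \<comment> \<open>Here \<open>c\<close> is meant as an edge, namely the element of
      \<open>T\<close> that names its colour.\<close>
    have "c \<in> R"
    proof (rule kempe_class_subset[OF c(1) d(1) \<open>c \<noteq> d\<close> y(1) _ \<open>y \<in> R\<close>])
      fix e f assume "e \<in> R" "f \<in> E" "col f = c \<or> col f = d" "inc e \<inter> inc f \<noteq> {}"
      then show "f \<in> R" using closed[of e f] c(2) d(2) by blast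
    qed (use y c col_T T_subset in auto)
    then show False using c R(3) by blast
  qed
  have sub: "col ` S \<subseteq> T" using S(1) col_in_T by blast
  have "card (col ` S) \<le> card S" using finS card_image_le by blast
  then have less: "card (col ` S) < card T" using S(2) by simp
  then have "col ` S \<noteq> T" by auto
  then obtain c where c: "c \<in> T" "c \<notin> col ` S" using sub by blast
  have eq: "col ` S = T - {c}" using one[OF c] sub c by blast
  then have "card (col ` S) = card T - 1" using c finite_T by simp
  then have "card (col ` S) = card S" using \<open>card (col ` S) \<le> card S\<close> S(2) by simp
  then have "inj_on col S" using finS by (simp add: eq_card_imp_inj_on)
  then show thesis using that c eq by blast
qed

end

section \<open>Contracting the far side of a tight separator\<close>

locale tight_cut = kempe_graph E inc col T
  for E :: "'e set" and inc :: "'e \<Rightarrow> 'v set" and col :: "'e \<Rightarrow> 'e" and T :: "'e set" +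
  fixes v :: 'v and S R :: "'e set" and c :: 'e
  assumes full: "t \<in> T \<Longrightarrow> covered t v"
    and S_subset: "S \<subseteq> E" and R_subset: "R \<subseteq> E - S"
    and star: "{e \<in> E. v \<in> inc e} \<subseteq> R \<union> S"
    and T_R: "T \<inter> R = {}"
    and closed: "e \<in> R \<Longrightarrow> f \<in> E - S \<Longrightarrow> inc e \<inter> inc f \<noteq> {} \<Longrightarrow> f \<in> R"
    and c_in_T: "c \<in> T" and inj_S: "inj_on col S" and col_S: "col ` S = T - {c}"
begin

definition W :: "'v set" where "W = insert v (\<Union> (inc ` R))"

text \<open>Contraction of \<open>W\<close> to \<open>v\<close> changes only the incidence function.
  The edges of \<open>R\<close> would become loops; they are removed by passing to
  \<open>E - R\<close>.\<close>

definition inc' :: "'e \<Rightarrow> 'v set" where "inc' e = (\<lambda>x. if x \<in> W then v else x) ` inc e"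

lemma R_at_v: "\<exists>y\<in>R. v \<in> inc y"
proof -
  obtain y where "y \<in> E" "col y = c" "v \<in> inc y"
    using full[OF c_in_T] by (auto simp: covered_def)
  then show ?thesis using star col_S by blast
qed

lemma meets_W: "e \<in> E \<Longrightarrow> inc e \<inter> W \<noteq> {} \<Longrightarrow> e \<in> R \<union> S"
  using star closed by (auto simp: W_def)

lemma R_in_W: "e \<in> R \<Longrightarrow> inc e \<subseteq> W \<and> inc e \<noteq> {}"
  using R_subset card_inc by (force simp: W_def)

text \<open>The contraction must not create loops. If \<open>s\<close> lay inside \<open>W\<close>,
  the Kempe chain of \<open>c\<close> and \<open>col s\<close> through \<open>s\<close> would be
  confined to \<open>insert s R\<close>, because \<open>S\<close> has no edge of colour
  \<open>c\<close> and no other edge of colour \<open>col s\<close>. But the chain contains the edge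
  \<open>c\<close>, which is not there.\<close>

lemma S_not_inside:
  assumes s: "s \<in> S"
  shows "\<not> inc s \<subseteq> W"
proof
  assume inside: "inc s \<subseteq> W"
  have d: "col s \<in> T" "col s \<noteq> c" using col_S s by blast+
  have "c \<in> insert s R"
  proof (rule kempe_class_subset[OF c_in_T d(1) d(2)[symmetric], where x = s])
    fix e f assume *: "e \<in> insert s R" "f \<in> E" "col f = c \<or> col f = col s" "inc e \<inter> inc f \<noteq> {}"
    show "f \<in> insert s R"
    proof (cases "f \<in> S")
      case True
      then have "col f = col s" using * col_S by blast
      then show ?thesis using inj_S True s by (auto dest: inj_onD)
    next
      case False
      then show ?thesis using * closed[of e f] meets_W[of f] inside by blast
    qed
  qed (use s S_subset c_in_T T_subset col_T in auto)
  then show False using d T_R c_in_T col_T by auto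
qed

lemma inc'_meet:
  "inc' e \<inter> inc' f \<noteq> {} \<longleftrightarrow> inc e \<inter> inc f \<noteq> {} \<or> inc e \<inter> W \<noteq> {} \<and> inc f \<inter> W \<noteq> {}"
proof -
  have "v \<in> W" by (simp add: W_def)
  then show ?thesis by (auto simp: inc'_def split: if_splits)
qed

lemma card_inc': 
  assumes e: "e \<in> E - R"
  shows "card (inc' e) = 2"
proof -
  obtain a b where ab: "inc e = {a, b}" "a \<noteq> b"
    using card_inc[of e] e by (auto simp: card_2_iff)
  have "\<not> (a \<in> W \<and> b \<in> W)"
    using S_not_inside[of e] meets_W[of e] e ab by auto
  moreover have "v \<in> W" by (simp add: W_def)
  ultimately have "(if a \<in> W then v else a) \<noteq> (if b \<in> W then v else b)"
    using ab(2) by metis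
  moreover have "inc' e = {if a \<in> W then v else a, if b \<in> W then v else b}"
    by (simp only: inc'_def ab image_insert image_empty)
  ultimately show ?thesis by (simp only: card_2_iff) blast
qed

text \<open>A set closed after the contraction becomes closed in the original graph once all of
  \<open>R\<close> is added to it, provided that it touches \<open>W\<close>; otherwise it is closed
  already. This is the set \<open>D\<close>.\<close>

lemma kempe_contracted:
  assumes st: "s \<in> T" "t \<in> T" "s \<noteq> t"
  shows "edge_connected inc' {e \<in> E - R. col e = s \<or> col e = t}"
proof (rule edge_connectedI)
  let ?X = "{e \<in> E - R. col e = s \<or> col e = t}"
  fix C assume C: "C \<subseteq> ?X" "C \<noteq> {}"
    and cl: "\<And>e f. e \<in> C \<Longrightarrow> f \<in> ?X \<Longrightarrow> inc' e \<inter> inc' f \<noteq> {} \<Longrightarrow> f \<in> C"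
  obtain x where x: "x \<in> C" using C by blast
  define D where "D = C \<union> (if \<exists>g\<in>C. inc g \<inter> W \<noteq> {} then R else {})"
  show "?X \<subseteq> C"
  proof
    fix h assume h: "h \<in> ?X"
    have "h \<in> D"
    proof (rule kempe_class_subset[OF st, where x = x])
      fix e f assume *: "e \<in> D" "f \<in> E" "col f = s \<or> col f = t" "inc e \<inter> inc f \<noteq> {}"
      show "f \<in> D"
      proof (cases "\<exists>g\<in>C. inc g \<inter> W \<noteq> {}")
        case True
        then obtain g where g: "g \<in> C" "inc g \<inter> W \<noteq> {}" by blast
        have "f \<in> C" if "f \<notin> R"
        proof (cases "e \<in> C")
          case True
          then show ?thesis using cl[of e f] * that by (auto simp: inc'_meet)
        next
          case False
          then have "inc f \<inter> W \<noteq> {}" using * R_in_W by (auto simp: D_def split: if_splits)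
          then show ?thesis using cl[OF g(1), of f] g * that by (auto simp: inc'_meet)
        qed
        then show ?thesis using True by (auto simp: D_def)
      next
        case False
        then have e: "e \<in> C" "inc e \<inter> W = {}" using * by (auto simp: D_def)
        then have "f \<notin> R" using * R_in_W by blast
        then show ?thesis using cl[of e f] e * by (auto simp: inc'_meet D_def)
      qed
    qed (use x C h in \<open>auto simp: D_def\<close>)
    then show "h \<in> C" using h by (auto simp: D_def split: if_splits)
  qed
qed

text \<open>For properness: edges outside \<open>R\<close> that become incident at \<open>v\<close>
  both belong to \<open>S\<close>, where all colours are different.\<close>

lemma kempe_graph_contracted: "kempe_graph (E - R) inc' col T"
proof
  fix e f assume *: "e \<in> E - R" "f \<in> E - R" "e \<noteq> f" "col e = col f"
  then show "inc' e \<inter> inc' f = {}"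
    using inc'_meet[of e f] proper[of e f] meets_W[of e] meets_W[of f] inj_onD[OF inj_S, of e f] by blast
qed (use finite_E card_inc' T_subset T_R col_T col_in_T kempe_contracted in auto)

lemma card_contracted: "card (E - R) < card E"
  using R_at_v R_subset finite_E by (intro psubset_card_mono) auto

text \<open>
  Edges that become incident by the contraction lie in \<open>S\<close>, and the sets \<open>P s\<close> make them
  meet at \<open>v\<close>.
\<close>

lemma lift_rooted_minor:
  assumes P: "\<And>s. s \<in> S \<Longrightarrow> s \<in> P s \<and> P s \<subseteq> E \<and> edge_connected inc (P s) \<and> P s \<inter> {e \<in> E. v \<in> inc e} \<noteq> {}"
    and Pdisj: "\<And>s t. s \<in> S \<Longrightarrow> t \<in> S \<Longrightarrow> s \<noteq> t \<Longrightarrow> P s \<inter> P t = {}"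
    and B: "rooted_minor inc' (E - R) T B"
  shows "\<exists>B. rooted_minor inc E T B"
proof -
  \<comment> \<open>Each linking set is cut down to its part on the side of \<open>v\<close>. A
    branching set \<open>B t\<close> lies in \<open>E - R\<close>, so it meets \<open>Q s\<close> in
    \<open>s\<close> at most.\<close>
  define Q where "Q s = P s \<inter> insert s R" for s
  have PS: "e = s" if "e \<in> P s" "e \<in> S" "s \<in> S" for e s
    using that P[of e] Pdisj[of e s] by blast
  have Qs: "s \<in> Q s" "Q s \<subseteq> insert s R" if "s \<in> S" for s
    using P[OF that] by (auto simp: Q_def)
  have Qv: "\<exists>y\<in>Q s. v \<in> inc y" if s: "s \<in> S" for s
  proof -
    obtain y where "y \<in> P s" "y \<in> E" "v \<in> inc y" using P[OF s] by blast
    then show ?thesis using star PS[of y s] s by (auto simp: Q_def)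
  qed
  have Qconn: "edge_connected inc (Q s)" if s: "s \<in> S" for s
  proof (rule edge_connectedI)
    fix C assume C: "C \<subseteq> Q s" "C \<noteq> {}"
      and cl: "\<And>e f. e \<in> C \<Longrightarrow> f \<in> Q s \<Longrightarrow> inc e \<inter> inc f \<noteq> {} \<Longrightarrow> f \<in> C"
    have conn: "edge_connected inc (P s)" and PE: "P s \<subseteq> E" using P[OF s] by blast+
    obtain x where x: "x \<in> C" using C by blast
    \<comment> \<open>A closed piece without \<open>s\<close> lies in \<open>R\<close>. Its
      neighbours in \<open>P s\<close> lie in \<open>R\<close> or \<open>S\<close>, and
      \<open>s\<close> is the only element of \<open>S\<close> there, so the piece grows only inside
      \<open>Q s\<close> and must reach \<open>s\<close>.\<close>
    have "s \<in> C"
    proof (rule ccontr)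
      assume "s \<notin> C"
      then have CR: "C \<subseteq> R" using C Qs(2)[OF s] by blast
      have "s \<in> C"
      proof (rule edge_connectedD[OF conn _ x])
        fix e f assume *: "e \<in> C" "f \<in> P s" "inc e \<inter> inc f \<noteq> {}"
        have "f \<in> Q s"
          using PS[of f s] closed[of e f] * s CR PE Qs(1)[OF s] by (auto simp: Q_def)
        then show "f \<in> C" using cl * by blast
      qed (use x C P[OF s] in \<open>auto simp: Q_def\<close>)
      then show False using \<open>s \<notin> C\<close> by blast
    qed
    show "Q s \<subseteq> C"
    proof
      fix h assume h: "h \<in> Q s"
      \<comment> \<open>The discarded edges are put back. By \<open>closed\<close> none of them
        meets an edge of \<open>R\<close>, so they are attached to \<open>Q s\<close> only at
        \<open>s\<close>.\<close>
      have "h \<in> C \<union> (P s - insert s R)"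
      proof (rule edge_connectedD[OF conn, of s])
        fix e f assume *: "e \<in> C \<union> (P s - insert s R)" "f \<in> P s" "inc e \<inter> inc f \<noteq> {}"
        show "f \<in> C \<union> (P s - insert s R)"
        proof (cases "e \<in> C")
          case True
          then show ?thesis using cl[of e f] * by (auto simp: Q_def)
        next
          case False
          then have "e \<in> E - S" "e \<notin> R" using * PS[of e s] PE s by auto
          then show ?thesis using closed[of f e] * \<open>s \<in> C\<close> by blast
        qed
      qed (use h \<open>s \<in> C\<close> P[OF s] in \<open>auto simp: Q_def\<close>)
      then show "h \<in> C" using h by (auto simp: Q_def)
    qed
  qed
  have B1: "t \<in> B t" "B t \<subseteq> E - R" "edge_connected inc' (B t)" if "t \<in> T" for t
    using B that by (auto simp: rooted_minor_def)
  have B2: "B s \<inter> B t = {}" "\<exists>e\<in>B s. \<exists>f\<in>B t. inc' e \<inter> inc' f \<noteq> {}"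
    if "s \<in> T" "t \<in> T" "s \<noteq> t" for s t
    using B that unfolding rooted_minor_def by blast+
  have at_v: "e \<in> S" if "t \<in> T" "e \<in> B t" "inc e \<inter> W \<noteq> {}" for e t
    using meets_W[of e] B1(2)[OF that(1)] that by blast
  \<comment> \<open>Wherever a branching set uses an edge of the separator, the link from that edge
    to \<open>v\<close> is added.\<close>
  define B' where "B' t = B t \<union> (\<Union>s\<in>B t \<inter> S. Q s)" for t
  have "edge_connected inc (B' t)" if t: "t \<in> T" for t
  proof (rule edge_connectedI)
    fix C assume C: "C \<subseteq> B' t" "C \<noteq> {}"
      and cl: "\<And>e f. e \<in> C \<Longrightarrow> f \<in> B' t \<Longrightarrow> inc e \<inter> inc f \<noteq> {} \<Longrightarrow> f \<in> C"
    have QC: "Q s \<subseteq> C" if s: "s \<in> B t" "s \<in> S" and meet: "x \<in> C" "x \<in> Q s" for s x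
    proof
      fix h assume "h \<in> Q s"
      then show "h \<in> C"
      proof (rule edge_connectedD[OF Qconn[OF s(2)] meet(2,1)])
        fix e f assume "e \<in> C" "f \<in> Q s" "inc e \<inter> inc f \<noteq> {}"
        then show "f \<in> C" using cl[of e f] s by (auto simp: B'_def)
      qed
    qed
    obtain x where x: "x \<in> C" "x \<in> B t"
      using C QC Qs(1) unfolding B'_def by blast
    have "B t \<subseteq> C"
    proof
      fix h assume "h \<in> B t"
      then show "h \<in> C"
      proof (rule edge_connectedD[OF B1(3)[OF t] x(2,1)])
        fix e f assume *: "e \<in> C" "e \<in> B t" "f \<in> B t" "inc' e \<inter> inc' f \<noteq> {}"
        show "f \<in> C"
        proof (cases "inc e \<inter> inc f = {}")
          case False
          then show ?thesis using cl[of e f] * by (auto simp: B'_def)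
        next
          case True
          \<comment> \<open>Edges that meet only after the contraction lie in \<open>S\<close>, and
            their links meet at \<open>v\<close>.\<close>
          then have S: "e \<in> S" "f \<in> S" using * at_v[OF t] by (auto simp: inc'_meet)
          obtain y z where "y \<in> Q e" "v \<in> inc y" "z \<in> Q f" "v \<in> inc z"
            using Qv S by blast
          moreover have "Q e \<subseteq> C" using QC[OF *(2) S(1) *(1) Qs(1)[OF S(1)]] .
          moreover have "z \<in> B' t" using \<open>z \<in> Q f\<close> * S by (auto simp: B'_def)
          ultimately have "z \<in> C" using cl[of y z] by blast
          then show ?thesis using QC[OF *(3) S(2) _ \<open>z \<in> Q f\<close>] Qs(1)[OF S(2)] by blast
        qed
      qed
    qed
    then show "B' t \<subseteq> C" using QC Qs(1) unfolding B'_def by blast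
  qed
  moreover have "t \<in> B' t \<and> B' t \<subseteq> E" if t: "t \<in> T" for t
  proof -
    have "Q s \<subseteq> E" if "s \<in> S" for s using Qs(2)[OF that] that S_subset R_subset by blast
    then show ?thesis using B1[OF t] by (auto simp: B'_def)
  qed
  moreover have "B' s \<inter> B' t = {}" if st: "s \<in> T" "t \<in> T" "s \<noteq> t" for s t
  proof -
    have QQ: "Q e \<inter> Q f = {}" if "e \<in> B s \<inter> S" "f \<in> B t \<inter> S" for e f
      using Pdisj[of e f] B2(1)[OF st] that by (auto simp: Q_def)
    have QB: "Q e \<inter> B t = {}" if "e \<in> B s \<inter> S" for e
      using Qs(2)[of e] B2(1)[OF st] B1(2)[OF st(2)] that by blast
    have BQ: "B s \<inter> Q f = {}" if "f \<in> B t \<inter> S" for f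
      using Qs(2)[of f] B2(1)[OF st] B1(2)[OF st(1)] that by blast
    have "B' s \<inter> Q f = {}" if "f \<in> B t \<inter> S" for f
      using QQ[OF _ that] QB BQ[OF that] B2(1)[OF st] by (auto simp: B'_def)
    moreover have "B' s \<inter> B t = {}"
      using QB B2(1)[OF st] by (auto simp: B'_def)
    ultimately show ?thesis unfolding B'_def[of t] by auto
  qed
  moreover have "\<exists>e\<in>B' s. \<exists>f\<in>B' t. inc e \<inter> inc f \<noteq> {}" if st: "s \<in> T" "t \<in> T" "s \<noteq> t" for s t
  proof -
    obtain e f where ef: "e \<in> B s" "f \<in> B t" "inc' e \<inter> inc' f \<noteq> {}" using B2(2)[OF st] by blast
    show ?thesis
    proof (cases "inc e \<inter> inc f = {}")
      case False
      then show ?thesis using ef by (auto simp: B'_def)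
    next
      case True
      then have S: "e \<in> S" "f \<in> S" using ef at_v st by (auto simp: inc'_meet)
      obtain y z where "y \<in> Q e" "v \<in> inc y" "z \<in> Q f" "v \<in> inc z"
        using Qv S by blast
      moreover have "y \<in> B' s" "z \<in> B' t"
        using ef(1,2) S \<open>y \<in> Q e\<close> \<open>z \<in> Q f\<close> unfolding B'_def by blast+
      ultimately show ?thesis by blast
    qed
  qed
  ultimately have "rooted_minor inc E T B'"
    by (simp add: rooted_minor_def)
  then show ?thesis by blast
qed

end

text \<open>If \<open>T\<close> is linked to \<open>v\<close>, the linking sets meet pairwise at
  \<open>v\<close>. Otherwise any separator with fewer than \<open>card T\<close> edges will do: by
  \<open>separator_colours\<close> all of these have \<open>card T - 1\<close> edges, so no smaller
  one can prevent the second linking, from \<open>S\<close> to \<open>v\<close>.\<close>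

lemma (in kempe_graph) full_vertex_step:
  assumes full: "\<And>t. t \<in> T \<Longrightarrow> covered t v"
    and IH: "\<And>E' inc'. card E' < card E \<Longrightarrow> kempe_graph E' (inc' :: 'e \<Rightarrow> 'v set) col T \<Longrightarrow>
      \<exists>B. rooted_minor inc' E' T B"
  shows "\<exists>B. rooted_minor inc E T B"
proof (rule linking[OF finite_E T_subset, of "{e \<in> E. v \<in> inc e}" inc])
  show "{e \<in> E. v \<in> inc e} \<subseteq> E" by blast
next
  fix P
  assume P: "\<And>x. x \<in> T \<Longrightarrow> x \<in> P x \<and> P x \<subseteq> E \<and> edge_connected inc (P x) \<and> P x \<inter> {e \<in> E. v \<in> inc e} \<noteq> {}"
    and Pdisj: "\<And>x x'. x \<in> T \<Longrightarrow> x' \<in> T \<Longrightarrow> x \<noteq> x' \<Longrightarrow> P x \<inter> P x' = {}"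
  have "\<exists>e\<in>P s. \<exists>f\<in>P t. inc e \<inter> inc f \<noteq> {}" if "s \<in> T" "t \<in> T" for s t
    using P[OF that(1)] P[OF that(2)] by blast
  then have "rooted_minor inc E T P"
    using P Pdisj unfolding rooted_minor_def by blast
  then show ?thesis by blast
next
  fix S R
  assume S: "S \<subseteq> E" "card S < card T"
    and R: "R \<subseteq> E - S" "{e \<in> E. v \<in> inc e} \<subseteq> R \<union> S" "T \<inter> R = {}"
    and closed: "\<And>e f. e \<in> R \<Longrightarrow> f \<in> E - S \<Longrightarrow> inc e \<inter> inc f \<noteq> {} \<Longrightarrow> f \<in> R"
  obtain c where c: "c \<in> T" "inj_on col S" "col ` S = T - {c}"
    by (rule separator_colours[OF full S R closed])
  interpret tight_cut E inc col T v S R c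
    by unfold_locales (use full S R closed c in auto)
  obtain B where B: "rooted_minor inc' (E - R) T B"
    using IH[OF card_contracted kempe_graph_contracted] by blast
  show ?thesis
  proof (rule linking[OF finite_E S(1), of "{e \<in> E. v \<in> inc e}" inc])
    show "{e \<in> E. v \<in> inc e} \<subseteq> E" by blast
  next
    fix P
    assume "\<And>x. x \<in> S \<Longrightarrow> x \<in> P x \<and> P x \<subseteq> E \<and> edge_connected inc (P x) \<and> P x \<inter> {e \<in> E. v \<in> inc e} \<noteq> {}"
      "\<And>x x'. x \<in> S \<Longrightarrow> x' \<in> S \<Longrightarrow> x \<noteq> x' \<Longrightarrow> P x \<inter> P x' = {}"
    then show ?thesis using lift_rooted_minor B by blast
  next
    fix S2 R2
    assume S2: "S2 \<subseteq> E" "card S2 < card S"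
      and R2: "R2 \<subseteq> E - S2" "{e \<in> E. v \<in> inc e} \<subseteq> R2 \<union> S2" "S \<inter> R2 = {}"
      and closed2: "\<And>e f. e \<in> R2 \<Longrightarrow> f \<in> E - S2 \<Longrightarrow> inc e \<inter> inc f \<noteq> {} \<Longrightarrow> f \<in> R2"
    have "card S2 < card T" using S2 S by simp
    \<comment> \<open>\<open>S2\<close> also separates \<open>T\<close> from \<open>v\<close>, with
      \<open>R2 \<inter> R\<close> as the side of \<open>v\<close>: since \<open>R2\<close> avoids
      \<open>S\<close>, a step inside \<open>R2\<close> that starts in \<open>R\<close> stays in
      \<open>R\<close>.\<close>
    moreover have "R2 \<inter> R \<subseteq> E - S2" "{e \<in> E. v \<in> inc e} \<subseteq> R2 \<inter> R \<union> S2" "T \<inter> (R2 \<inter> R) = {}"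
      using R R2 by blast+
    moreover have "f \<in> R2 \<inter> R" if "e \<in> R2 \<inter> R" "f \<in> E - S2" "inc e \<inter> inc f \<noteq> {}" for e f
      using closed[of e f] closed2[of e f] that R2(3) by blast
    ultimately obtain d where d: "d \<in> T" "inj_on col S2" "col ` S2 = T - {d}"
      using separator_colours[of v S2 "R2 \<inter> R"] full S2(1) by blast
    have "card S2 = card T - 1" using card_image[OF d(2)] d finite_T by simp
    then show ?thesis using S2(2) S(2) by simp
  qed
qed

section \<open>The vertices covered by a colour\<close>

text \<open>Grow a connected edge set one edge at a time: each new edge meets the previous ones and
  adds at most one vertex.\<close>

lemma card_vertices_le:
  assumes "finite X" "X \<noteq> {}" "edge_connected inc X" "\<And>e. e \<in> X \<Longrightarrow> card (inc e) = 2"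
  shows "card (\<Union> (inc ` X)) \<le> Suc (card X)"
proof -
  have fin: "finite (inc e)" if "e \<in> X" for e
    using assms(4)[OF that] by (simp add: card_ge_0_finite)
  have "\<exists>Y\<subseteq>X. card Y = Suc n \<and> card (\<Union> (inc ` Y)) \<le> Suc (Suc n)" if "Suc n \<le> card X" for n
    using that
  proof (induction n)
    case 0
    obtain e where "e \<in> X" using assms(2) by blast
    then show ?case using assms(4) by (intro exI[of _ "{e}"]) auto
  next
    case (Suc n)
    then obtain Y where Y: "Y \<subseteq> X" "card Y = Suc n" "card (\<Union> (inc ` Y)) \<le> Suc (Suc n)" by auto
    then have "Y \<noteq> X" "Y \<noteq> {}" using Suc.prems by auto
    then obtain e f where ef: "e \<in> Y" "f \<in> X" "f \<notin> Y" "inc e \<inter> inc f \<noteq> {}"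
      using assms(3)[unfolded edge_connected_def, rule_format, OF Y(1)] by blast
    have finY: "finite Y" using Y assms(1) finite_subset by blast
    have finU: "finite (\<Union> (inc ` Y))" using finY fin Y(1) by blast
    have "\<Union> (inc ` insert f Y) = \<Union> (inc ` Y) \<union> (inc f - \<Union> (inc ` Y))" by auto
    moreover have "card (inc f - \<Union> (inc ` Y)) \<le> 1"
    proof -
      have "inc f - \<Union> (inc ` Y) \<subset> inc f" using ef by blast
      then have "card (inc f - \<Union> (inc ` Y)) < card (inc f)" using fin[OF ef(2)] by (rule psubset_card_mono[rotated])
      then show ?thesis using assms(4)[OF ef(2)] by simp
    qed
    ultimately have "card (\<Union> (inc ` insert f Y)) \<le> Suc (Suc (Suc n))"
      using card_Un_le[of "\<Union> (inc ` Y)" "inc f - \<Union> (inc ` Y)"] Y(3) by simp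
    moreover have "card (insert f Y) = Suc (Suc n)" using finY ef(3) Y(2) by simp
    ultimately show ?case using ef(2) Y(1) by (intro exI[of _ "insert f Y"]) blast
  qed
  moreover obtain n where n: "card X = Suc n"
    using assms(1,2) by (metis card_gt_0_iff gr0_implies_Suc)
  ultimately obtain Y where "Y \<subseteq> X" "card Y = card X" "card (\<Union> (inc ` Y)) \<le> Suc (card X)"
    by (metis order_refl)
  then show ?thesis using assms(1) card_subset_eq by metis
qed

section \<open>Colour classes as matchings and the vertex sets they cover\<close>

context kempe_graph
begin

definition colour_class :: "'e \<Rightarrow> 'e set" where "colour_class t = {e \<in> E. col e = t}"

definition V :: "'e \<Rightarrow> 'v set" where "V t = \<Union> (inc ` colour_class t)"

lemma covered_iff: "covered t v \<longleftrightarrow> v \<in> V t"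
  by (auto simp: covered_def V_def colour_class_def)

lemma finite_inc: "e \<in> E \<Longrightarrow> finite (inc e)"
  using card_inc by (simp add: card_ge_0_finite)

lemma finite_colour_class: "finite (colour_class t)"
  using finite_E by (simp add: colour_class_def)

lemma finite_V: "finite (V t)"
  using finite_E finite_inc by (auto simp: V_def colour_class_def)

lemma T_in_class: "t \<in> T \<Longrightarrow> t \<in> colour_class t"
  using T_subset col_T by (auto simp: colour_class_def)

lemma card_V: "card (V t) = 2 * card (colour_class t)"
proof -
  have "card (V t) = (\<Sum>e\<in>colour_class t. card (inc e))"
    unfolding V_def using proper finite_inc finite_colour_class
    by (intro card_UN_disjoint) (auto simp: colour_class_def)
  also have "\<dots> = (\<Sum>e\<in>colour_class t. 2)"
    using card_inc by (intro sum.cong) (auto simp: colour_class_def)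
  finally show ?thesis by simp
qed

lemma card_V_ge_2:
  assumes "t \<in> T"
  shows "2 \<le> card (V t)"
proof -
  have "0 < card (colour_class t)"
    using T_in_class[OF assms] finite_colour_class card_gt_0_iff by blast
  then show ?thesis by (simp add: card_V)
qed

text \<open>The union of two classes is connected, so it spans at most one vertex more than its
  number of edges. That number is half of \<open>card (V s) + card (V t)\<close>.\<close>

lemma kempe_symdiff:
  assumes "s \<in> T" "t \<in> T"
  shows "card (V s - V t) + card (V t - V s) \<le> 2"
proof (cases "s = t")
  case False
  have conn: "edge_connected inc (colour_class s \<union> colour_class t)"
    using kempe[OF assms False] by (simp add: colour_class_def Collect_disj_eq[symmetric] conj_disj_distribL)
  have "card (colour_class s \<union> colour_class t) = card (colour_class s) + card (colour_class t)"
    using False finite_colour_class by (intro card_Un_disjoint) (auto simp: colour_class_def)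
  moreover have "card (\<Union> (inc ` (colour_class s \<union> colour_class t))) \<le> Suc (card (colour_class s \<union> colour_class t))"
    using conn T_in_class[OF assms(1)] finite_colour_class card_inc
    by (intro card_vertices_le) (auto simp: colour_class_def)
  ultimately have "2 * card (V s \<union> V t) \<le> card (V s) + card (V t) + 2"
    by (simp add: V_def[symmetric] card_V image_Un)
  moreover have "card (V s) + card (V t) = card (V s \<union> V t) + card (V s \<inter> V t)"
    using finite_V by (intro card_Un_Int)
  moreover have "card (V s) = card (V s - V t) + card (V s \<inter> V t)"
    using card_Diff_subset_Int[of "V s" "V t"] card_mono[of "V s" "V s \<inter> V t"] finite_V by simp
  moreover have "card (V t) = card (V t - V s) + card (V s \<inter> V t)"
    using card_Diff_subset_Int[of "V t" "V s"] card_mono[of "V t" "V s \<inter> V t"] finite_V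
    by (simp add: Int_commute)
  ultimately show ?thesis by simp
qed simp

text \<open>An edge missing \<open>V s\<close> would be a whole Kempe chain by itself, without any
  edge of colour \<open>s\<close>.\<close>

lemma edge_meets_V:
  assumes "s \<in> T" "t \<in> T" "s \<noteq> t" "g \<in> colour_class t"
  shows "inc g \<inter> V s \<noteq> {}"
proof
  assume empty: "inc g \<inter> V s = {}"
  have "s \<in> {g}"
  proof (rule kempe_class_subset[OF assms(1-3), where x = g])
    fix e f assume "e \<in> {g}" "f \<in> E" "col f = s \<or> col f = t" "inc e \<inter> inc f \<noteq> {}"
    then show "f \<in> {g}"
      using empty proper[of f g] assms(4) by (auto simp: V_def colour_class_def)
  qed (use assms T_in_class[of s] in \<open>auto simp: colour_class_def\<close>)
  then show False using assms col_T by (auto simp: colour_class_def)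
qed

text \<open>The sizes are even, so by \<open>kempe_symdiff\<close> unequal ones mean that
  \<open>V j\<close> is \<open>V i\<close> with two vertices \<open>a\<close>, \<open>b\<close>
  added. Colours missing the partners of \<open>a\<close> and \<open>b\<close> in class
  \<open>j\<close> then cover sets too far apart.\<close>

lemma card_V_eq:
  assumes nofull: "\<And>v. \<exists>t\<in>T. v \<notin> V t" and ij: "i \<in> T" "j \<in> T"
  shows "card (V i) = card (V j)"
proof -
  have "\<not> card (V i) < card (V j)" if i: "i \<in> T" and j: "j \<in> T" for i j
  proof
    assume less: "card (V i) < card (V j)"
    then have "i \<noteq> j" by auto
    have "card (V i) + 2 \<le> card (V j)" using less by (simp add: card_V)
    moreover have "card (V i) = card (V i - V j) + card (V i \<inter> V j)"
      using card_Diff_subset_Int[of "V i" "V j"] card_mono[of "V i" "V i \<inter> V j"] finite_V by simp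
    moreover have "card (V j) = card (V j - V i) + card (V i \<inter> V j)"
      using card_Diff_subset_Int[of "V j" "V i"] card_mono[of "V j" "V i \<inter> V j"] finite_V
      by (simp add: Int_commute)
    ultimately have "card (V i - V j) = 0" "card (V j - V i) = 2"
      using kempe_symdiff[OF i j] by linarith+
    then obtain a b where ab: "V j - V i = {a, b}" "a \<noteq> b" and sub: "V i \<subseteq> V j"
      using finite_V by (auto simp: card_2_iff)
    have "a \<in> V j" "b \<in> V j" using ab(1) by blast+
    then obtain g h where g: "g \<in> colour_class j" "a \<in> inc g" and h: "h \<in> colour_class j" "b \<in> inc h"
      by (auto simp: V_def)
    obtain a' where a': "a' \<in> inc g" "a' \<in> V i" using edge_meets_V[OF i j \<open>i \<noteq> j\<close> g(1)] by blast
    obtain b' where b': "b' \<in> inc h" "b' \<in> V i" using edge_meets_V[OF i j \<open>i \<noteq> j\<close> h(1)] by blast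
    have ne: "a \<notin> V i" "b \<notin> V i" "a' \<in> V j" "b' \<in> V j" using ab a' b' sub by blast+
    then have ne': "a' \<noteq> a" "a' \<noteq> b" "b' \<noteq> a" "b' \<noteq> b" using a' b' by blast+
    have gE: "g \<in> E" "h \<in> E" using g h by (auto simp: colour_class_def)
    have incg: "inc g = {a, a'}"
      using card_inc[OF gE(1)] g(2) a'(1) ne' card_subset_eq[of "inc g" "{a, a'}"] finite_inc[OF gE(1)] by auto
    have inch: "inc h = {b, b'}"
      using card_inc[OF gE(2)] h(2) b'(1) ne' card_subset_eq[of "inc h" "{b, b'}"] finite_inc[OF gE(2)] by auto
    have "a' \<noteq> b'"
    proof
      assume "a' = b'"
      then have "g = h" using proper[of g h] g h incg inch by (auto simp: colour_class_def)
      then show False using incg inch ab ne' by auto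
    qed
    \<comment> \<open>Colour \<open>l\<close> misses \<open>a'\<close> but must meet the edge
      \<open>{a, a'}\<close>, so it covers \<open>a\<close>: compared with \<open>V i\<close>, it
      has \<open>a\<close> instead of \<open>a'\<close>. Likewise \<open>k\<close> has
      \<open>b\<close> instead of \<open>b'\<close>.\<close>
    obtain l where l: "l \<in> T" "a' \<notin> V l" using nofull by blast
    have al: "a \<in> V l" using edge_meets_V[OF l(1) j _ g(1)] l incg ne by auto
    obtain k where k: "k \<in> T" "b' \<notin> V k" using nofull by blast
    have bk: "b \<in> V k" using edge_meets_V[OF k(1) j _ h(1)] k inch ne by auto
    have one: "V s - V i = {p} \<and> V i - V s = {q}" if "s \<in> T" "p \<in> V s - V i" "q \<in> V i - V s" for s p q
    proof -
      have "card (V s - V i) \<ge> 1" "card (V i - V s) \<ge> 1"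
        using that finite_V by (auto simp: Suc_le_eq card_gt_0_iff)
      then have "card (V s - V i) = 1" "card (V i - V s) = 1"
        using kempe_symdiff[OF \<open>s \<in> T\<close> i] by linarith+
      then obtain u w where uw: "V s - V i = {u}" "V i - V s = {w}"
        by (metis card_1_singletonE)
      then show ?thesis using that(2,3) unfolding uw by simp
    qed
    have 1: "V l - V i = {a} \<and> V i - V l = {a'}"
      by (rule one[OF l(1)]) (use al l a' ne in blast)+
    have 2: "V k - V i = {b} \<and> V i - V k = {b'}"
      by (rule one[OF k(1)]) (use bk k b' ne in blast)+
    have "a \<notin> V k"
    proof
      assume "a \<in> V k"
      then have "a \<in> {b}" using 2 ne(1) by blast
      then show False using ab(2) by simp
    qed
    moreover have "b \<notin> V l"
    proof
      assume "b \<in> V l"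
      then have "b \<in> {a}" using 1 ne(2) by blast
      then show False using ab(2) by simp
    qed
    moreover have "b' \<in> V l"
    proof (rule ccontr)
      assume "b' \<notin> V l"
      then have "b' \<in> {a'}" using 1 b'(2) by blast
      then show False using \<open>a' \<noteq> b'\<close> by simp
    qed
    moreover have "a' \<in> V k"
    proof (rule ccontr)
      assume "a' \<notin> V k"
      then have "a' \<in> {b'}" using 2 a'(2) by blast
      then show False using \<open>a' \<noteq> b'\<close> by simp
    qed
    \<comment> \<open>The two exchanges are independent, so \<open>V l\<close> and
      \<open>V k\<close> differ in four vertices.\<close>
    ultimately have "{a, b'} \<subseteq> V l - V k" "{a', b} \<subseteq> V k - V l"
      using al bk l(2) k(2) by blast+
    then have "card {a, b'} \<le> card (V l - V k)" "card {a', b} \<le> card (V k - V l)"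
      using finite_V by (meson card_mono finite_Diff)+
    then show False using kempe_symdiff[OF l(1) k(1)] ne' by simp
  qed
  then show ?thesis using ij by (meson linorder_neqE_nat)
qed

text \<open>Sets of equal size that pairwise differ by one exchange either share all but one element
  of each or are a common set minus a point. As no vertex is full, three colours can be chosen that
  force the second shape.\<close>

lemma V_eq_Diff_singleton:
  assumes nofull: "\<And>v. \<exists>t\<in>T. v \<notin> V t"
  obtains A where "finite A" "\<And>t. t \<in> T \<Longrightarrow> \<exists>y\<in>A. V t = A - {y}"
proof -
  have diff: "card (V s - V t) \<le> 1" if st: "s \<in> T" "t \<in> T" for s t
  proof -
    have "card (V s) = card (V s - V t) + card (V s \<inter> V t)"
      using card_Diff_subset_Int[of "V s" "V t"] card_mono[of "V s" "V s \<inter> V t"] finite_V by simp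
    moreover have "card (V t) = card (V t - V s) + card (V s \<inter> V t)"
      using card_Diff_subset_Int[of "V t" "V s"] card_mono[of "V t" "V s \<inter> V t"] finite_V
      by (simp add: Int_commute)
    ultimately show ?thesis using kempe_symdiff[OF st] card_V_eq[OF nofull st] by linarith
  qed
  then have diff1: "V s - V t = {p}" if "s \<in> T" "t \<in> T" "p \<in> V s - V t" for s t p
    using diff[OF that(1,2)] that(3) finite_V[of s] by (auto simp: card_le_Suc0_iff_eq)
  obtain t1 where t1: "t1 \<in> T" using nofull by blast
  obtain p where p: "p \<in> V t1" using card_V_ge_2[OF t1] by fastforce
  obtain t2 where t2: "t2 \<in> T" "p \<notin> V t2" using nofull by blast
  have 12: "V t1 - V t2 = {p}" using diff1[OF t1 t2(1)] p t2 by blast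
  have "V t2 - V t1 \<noteq> {}"
  proof
    assume "V t2 - V t1 = {}"
    then have "V t2 \<subset> V t1" using p t2 by blast
    then have "card (V t2) < card (V t1)" by (rule psubset_card_mono[OF finite_V])
    then show False using card_V_eq[OF nofull t1 t2(1)] by simp
  qed
  then obtain q where q: "q \<in> V t2 - V t1" by blast
  have 21: "V t2 - V t1 = {q}" using diff1[OF t2(1) t1 q] .
  have "V t1 \<noteq> {p}" using card_V_ge_2[OF t1] by auto
  then obtain c where c: "c \<in> V t1" "c \<noteq> p" using p by blast
  obtain t3 where t3: "t3 \<in> T" "c \<notin> V t3" using nofull by blast
  have 13: "V t1 - V t3 = {c}" using diff1[OF t1 t3(1)] c t3 by blast
  have 23: "V t2 - V t3 = {c}" using diff1[OF t2(1) t3(1)] c t3 12 by blast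
  have q3: "q \<in> V t3" using 23 q c by auto
  have 31: "V t3 - V t1 = {q}" using diff1[OF t3(1) t1] q3 q by blast
  have p3: "p \<in> V t3" using 13 p c by auto
  have 32: "V t3 - V t2 = {p}" using diff1[OF t3(1) t2(1)] p3 t2 by blast
  define A where "A = insert q (V t1)"
  have A2: "V t2 = A - {p}" and A3: "V t3 = A - {c}"
    using 12 21 13 31 q t2 c p unfolding A_def by blast+
  have A1: "V t1 = A - {q}" using q by (auto simp: A_def)
  have finA: "finite A" using finite_V by (simp add: A_def)
  have cardA: "card A = Suc (card (V t))" if "t \<in> T" for t
    using q finite_V card_V_eq[OF nofull that t1] by (simp add: A_def)
  have sub: "V t \<subseteq> A" if t: "t \<in> T" for t
  proof
    fix z assume z: "z \<in> V t"
    show "z \<in> A"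
    proof (rule ccontr)
      assume "z \<notin> A"
      then have "z \<notin> V t1" "z \<notin> V t2" "z \<notin> V t3" using A1 A2 A3 by simp_all
      then have "V t - V t1 = {z}" "V t - V t2 = {z}" "V t - V t3 = {z}"
        using diff1[OF t t1] diff1[OF t t2(1)] diff1[OF t t3(1)] z by simp_all
      \<comment> \<open>A vertex \<open>z\<close> outside \<open>A\<close> would use up the one
        allowed difference from all three sets, leaving too little room for the rest of
        \<open>V t\<close>.\<close>
      then have "V t - {z} \<subseteq> V t1 \<inter> V t2 \<inter> V t3" by blast
      also have "\<dots> = A - {p, q, c}" unfolding A1 A2 A3 by blast
      finally have "V t - {z} \<subseteq> A - {p, q, c}" .
      then have "card (V t - {z}) \<le> card (A - {p, q, c})"
        using finA by (intro card_mono) auto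
      moreover have "card (A - {p, q, c}) = card A - 3"
      proof -
        have "p \<noteq> q" "q \<noteq> c" using p q c by auto
        then have "card {p, q, c} = 3" using c by auto
        moreover have "{p, q, c} \<subseteq> A" using p q c by (auto simp: A_def)
        ultimately show ?thesis by (simp add: card_Diff_subset)
      qed
      ultimately show False
        using z finite_V cardA[OF t] card_V_ge_2[OF t] by simp
    qed
  qed
  show thesis
  proof (rule that[OF finA])
    fix t assume t: "t \<in> T"
    have "card (A - V t) = 1"
      using cardA[OF t] sub[OF t] finite_V by (simp add: card_Diff_subset)
    then obtain y where "A - V t = {y}" by (auto simp: card_1_singleton_iff)
    then show "\<exists>y\<in>A. V t = A - {y}" using sub[OF t] by blast
  qed
qed

lemma subcolouring:
  assumes "K \<subseteq> T"
  shows "kempe_graph {e \<in> E. col e \<in> K} inc col K"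
proof
  fix s t assume st: "s \<in> K" "t \<in> K" "s \<noteq> t"
  have "{e \<in> {e \<in> E. col e \<in> K}. col e = s \<or> col e = t} = {e \<in> E. col e = s \<or> col e = t}"
    using st by auto
  then show "edge_connected inc {e \<in> {e \<in> E. col e \<in> K}. col e = s \<or> col e = t}"
    using kempe[of s t] st assms by auto
qed (use finite_E card_inc T_subset col_T col_in_T proper assms in auto)

lemma class_card_le:
  assumes "F \<subseteq> colour_class t" "finite Z" "\<And>e. e \<in> F \<Longrightarrow> inc e \<inter> Z \<noteq> {}"
  shows "card F \<le> card Z"
proof -
  have "\<forall>e\<in>F. \<exists>z. z \<in> inc e \<inter> Z" using assms(3) by blast
  then obtain z where z: "\<And>e. e \<in> F \<Longrightarrow> z e \<in> inc e \<inter> Z" using bchoice by metis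
  have "inj_on z F"
  proof (rule inj_onI, rule ccontr)
    fix e f assume "e \<in> F" "f \<in> F" "z e = z f" "e \<noteq> f"
    then show False
      using z[of e] z[of f] proper[of e f] assms(1) by (auto simp: colour_class_def)
  qed
  then show ?thesis using z assms(2) by (intro card_inj_on_le[of z]) auto
qed

end

section \<open>Complete graphs of odd order\<close>

lemma (in kempe_graph) other_end:
  assumes "e \<in> E" "v \<in> inc e"
  obtains w where "w \<noteq> v" "inc e = {v, w}"
proof -
  obtain a b where "inc e = {a, b}" "a \<noteq> b"
    using card_inc[OF assms(1)] by (auto simp: card_2_iff)
  then show thesis using that[of a] that[of b] assms(2) by (metis insertE insert_commute singletonD)
qed

text \<open>A near-one-factorization of the complete graph on \<open>2 * m + 1\<close> vertices;
  \<open>x t\<close> is the vertex missed by colour \<open>t\<close>.\<close>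

locale near_factorization = kempe_graph E inc col T
  for E :: "'e set" and inc :: "'e \<Rightarrow> 'v set" and col :: "'e \<Rightarrow> 'e" and T :: "'e set" +
  fixes A :: "'v set" and x :: "'e \<Rightarrow> 'v" and m :: nat
  assumes finite_A: "finite A" and card_A: "card A = Suc (2 * m)" and m_ge_2: "2 \<le> m"
    and V_eq: "t \<in> T \<Longrightarrow> V t = A - {x t}" and bij_x: "bij_betw x T A"
    and inj_inc: "inj_on inc E" and inc_image: "inc ` E = {X. X \<subseteq> A \<and> card X = 2}"
begin

definition deg :: "'v \<Rightarrow> nat" where "deg u = card {t \<in> T. u \<in> inc t}"

lemma card_T: "card T = Suc (2 * m)"
  using bij_betw_same_card[OF bij_x] card_A by simp

lemma x_in_A: "t \<in> T \<Longrightarrow> x t \<in> A"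
  using bij_x by (auto simp: bij_betw_def)

lemma card_class: "t \<in> T \<Longrightarrow> card (colour_class t) = m"
  using card_V[of t] V_eq[of t] x_in_A[of t] finite_A card_A by simp

lemma inc_subset: "e \<in> E \<Longrightarrow> inc e \<subseteq> A"
  using inc_image by blast

lemma edge_between:
  assumes "p \<in> A" "q \<in> A" "p \<noteq> q"
  shows "\<exists>e\<in>E. inc e = {p, q}"
proof -
  have "{p, q} \<in> inc ` E" using assms by (auto simp: inc_image)
  then show ?thesis by auto
qed

lemma sum_deg:
  assumes "finite Z"
  shows "(\<Sum>u\<in>Z. deg u) = (\<Sum>t\<in>T. card (inc t \<inter> Z))"
proof -
  have "(\<Sum>u\<in>Z. deg u) = (\<Sum>u\<in>Z. \<Sum>t\<in>T. if u \<in> inc t then 1 else 0)"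
    by (intro sum.cong refl) (simp add: deg_def sum.If_cases finite_T Int_def)
  also have "\<dots> = (\<Sum>t\<in>T. \<Sum>u\<in>Z. if u \<in> inc t then 1 else 0)"
    by (rule sum.swap)
  also have "\<dots> = (\<Sum>t\<in>T. card (inc t \<inter> Z))"
    using assms by (intro sum.cong refl) (simp add: sum.If_cases Int_def conj_commute)
  finally show ?thesis .
qed

lemma card_cross_ge:
  assumes "W \<subseteq> A"
  shows "card W * card (A - W) \<le> card {e \<in> E. inc e \<inter> W \<noteq> {} \<and> \<not> inc e \<subseteq> W}"
proof -
  let ?X = "{e \<in> E. inc e \<inter> W \<noteq> {} \<and> \<not> inc e \<subseteq> W}"
  let ?f = "\<lambda>(p, q). {p, q}"
  have "inj_on ?f (W \<times> (A - W))"
    by (auto simp: inj_on_def doubleton_eq_iff)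
  then have "card (W \<times> (A - W)) = card (?f ` (W \<times> (A - W)))" by (simp add: card_image)
  also have "\<dots> \<le> card (inc ` ?X)"
  proof (rule card_mono)
    show "finite (inc ` ?X)" using finite_E by simp
    show "?f ` (W \<times> (A - W)) \<subseteq> inc ` ?X"
    proof
      fix Y assume "Y \<in> ?f ` (W \<times> (A - W))"
      then obtain p q where pq: "p \<in> W" "q \<in> A - W" "Y = {p, q}" by auto
      then obtain e where "e \<in> E" "inc e = {p, q}"
        using edge_between[of p q] assms by auto
      then show "Y \<in> inc ` ?X" using pq by (intro image_eqI[of _ _ e]) auto
    qed
  qed
  also have "\<dots> \<le> card ?X" using finite_E by (intro card_image_le) simp
  finally show ?thesis by (simp add: card_cartesian_product)
qed

text \<open>Without the colours \<open>c\<close> and \<open>j\<close>, a separator has one edge of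
  every remaining colour but one. All other edges leaving the vertex set \<open>W\<close> of
  \<open>R\<close> have colour \<open>c\<close> or \<open>j\<close>, and each of these matchings has
  at most as many of them as the smaller side has vertices. A complete graph has too many edges
  across for that.\<close>

lemma no_separator:
  assumes v: "v \<in> A" "\<And>u. u \<in> A \<Longrightarrow> deg u \<le> deg v"
    and c: "c \<in> T" "x c = v" and j: "j \<in> T" "v \<in> inc j"
    and K_def: "K = T - {c, j}" and E_def: "E' = {e \<in> E. col e \<in> K}"
    and S: "S \<subseteq> E'" "card S < card K"
    and R: "R \<subseteq> E' - S" "{e \<in> E'. v \<in> inc e} \<subseteq> R \<union> S" "K \<inter> R = {}"
    and closed: "\<And>e f. e \<in> R \<Longrightarrow> f \<in> E' - S \<Longrightarrow> inc e \<inter> inc f \<noteq> {} \<Longrightarrow> f \<in> R"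
  shows False
proof -
  interpret sub: kempe_graph E' inc col K
    unfolding E_def by (rule subcolouring) (auto simp: K_def)
  have "v \<notin> V c" using V_eq[OF c(1)] c(2) by simp
  moreover have "v \<in> V j" using T_in_class[OF j(1)] j(2) by (auto simp: V_def)
  ultimately have cj: "c \<noteq> j" by auto
  then have cardK: "card K = 2 * m - 1"
    using c(1) j(1) finite_T card_T by (simp add: K_def card_Diff_subset)
  have full: "sub.covered t v" if t: "t \<in> K" for t
  proof -
    have "x t \<noteq> x c" using t c(1) bij_x by (auto simp: K_def bij_betw_def inj_on_def)
    then have "v \<in> V t" using V_eq[of t] t v(1) c(2) by (auto simp: K_def)
    then obtain e where "e \<in> E" "col e = t" "v \<in> inc e" by (auto simp: V_def colour_class_def)
    then show ?thesis unfolding sub.covered_def using t by (auto simp: E_def)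
  qed
  obtain l where l: "l \<in> K" "inj_on col S" "col ` S = K - {l}"
    by (rule sub.separator_colours[OF full S R closed])
  have finK: "finite K" using finite_T by (simp add: K_def)
  have finS: "finite S" using S(1) finite_E by (auto simp: E_def intro: finite_subset)
  have cardS: "card S = 2 * m - 2"
    using card_image[OF l(2)] l(1,3) cardK finK by simp
  define W where "W = \<Union> (inc ` R)"
  have RE: "R \<subseteq> E" using R(1) by (auto simp: E_def)
  have WA: "W \<subseteq> A" using RE inc_subset by (auto simp: W_def)
  have finW: "finite W" using WA finite_A finite_subset by blast
  obtain y where y: "y \<in> E'" "col y = l" "v \<in> inc y"
    using full[OF l(1)] by (auto simp: sub.covered_def)
  then have yR: "y \<in> R" using R(2) l(3) by blast
  have vW: "v \<in> W" using y(3) yR by (auto simp: W_def)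
  have "card (inc y) \<le> card W" using yR finW by (intro card_mono) (auto simp: W_def)
  then have w2: "2 \<le> card W" using card_inc[of y] y(1) by (simp add: E_def)
  have in_R: "e \<in> R" if "e \<in> E'" "e \<notin> S" "inc e \<inter> W \<noteq> {}" for e
    using closed[of _ e] that by (auto simp: W_def)
  have K_S: "t \<in> S \<or> inc t \<inter> W = {}" if "t \<in> K" for t
  proof -
    have "t \<in> E'" using that T_subset col_T by (auto simp: E_def K_def)
    then show ?thesis using in_R[of t] R(3) that by blast
  qed
  have cardWA: "card W + card (A - W) = Suc (2 * m)"
    using card_A WA finite_A finW card_mono[OF finite_A WA] by (simp add: card_Diff_subset)
  \<comment> \<open>With fewer than two vertices outside \<open>W\<close>, every element of
    \<open>K\<close> would meet \<open>W\<close> and hence lie in \<open>S\<close>.\<close>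
  have u2: "2 \<le> card (A - W)"
  proof (rule ccontr)
    assume *: "\<not> ?thesis"
    have "t \<in> S" if t: "t \<in> K" for t
    proof (rule ccontr)
      assume "t \<notin> S"
      then have tE: "t \<in> E" and "inc t \<subseteq> A - W"
        using K_S[OF t] T_subset t inc_subset by (auto simp: K_def)
      then have "card (inc t) \<le> card (A - W)" using finite_A by (intro card_mono) auto
      then show False using * card_inc[OF tE] by simp
    qed
    then have "card K \<le> card S" using finS by (intro card_mono) auto
    then show False using S(2) by simp
  qed
  define X where "X = {e \<in> E. inc e \<inter> W \<noteq> {} \<and> \<not> inc e \<subseteq> W}"
  define X' where "X' t = X \<inter> colour_class t" for t
  have finX: "finite X" using finite_E by (simp add: X_def)
  have "X \<subseteq> (S \<inter> X) \<union> (X' c \<union> X' j)"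
  proof
    fix e assume e: "e \<in> X"
    then have eE: "e \<in> E" "inc e \<inter> W \<noteq> {}" "\<not> inc e \<subseteq> W" by (auto simp: X_def)
    have "e \<notin> R" using eE(3) by (auto simp: W_def)
    then have "e \<notin> E' \<or> e \<in> S" using in_R[of e] eE by blast
    then show "e \<in> (S \<inter> X) \<union> (X' c \<union> X' j)"
      using e eE(1) col_in_T by (auto simp: E_def K_def X'_def colour_class_def)
  qed
  then have "card X \<le> card ((S \<inter> X) \<union> (X' c \<union> X' j))"
    using finX by (intro card_mono) (auto simp: X'_def)
  also have "\<dots> \<le> card (S \<inter> X) + (card (X' c) + card (X' j))"
    using card_Un_le[of "S \<inter> X"] card_Un_le[of "X' c" "X' j"] by (meson add_left_mono order_trans)
  finally have cX: "card X \<le> card (S \<inter> X) + (card (X' c) + card (X' j))" .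
  have SX: "card (S \<inter> X) \<le> 2 * m - 2" using card_mono[OF finS, of "S \<inter> X"] cardS by simp
  have X'W: "card (X' t) \<le> card W" for t
    by (rule class_card_le[OF _ finW]) (auto simp: X'_def X_def)
  have X'U: "card (X' t) \<le> card (A - W)" for t
  proof (rule class_card_le)
    fix e assume "e \<in> X' t"
    then show "inc e \<inter> (A - W) \<noteq> {}" using inc_subset[of e] by (auto simp: X'_def X_def)
  qed (use finite_A in \<open>auto simp: X'_def\<close>)
  have cross: "card W * card (A - W) \<le> card X"
    using card_cross_ge[OF WA] by (simp add: X_def)
  \<comment> \<open>Counting the edges that leave \<open>W\<close> gives \<open>(p - 1) * (q - 3) \<le> 0\<close> for the sizes \<open>p \<le> q\<close> of the two
    sides, which leaves only five vertices; there the maximal degree of \<open>v\<close> is needed.\<close>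
  define p where "p = min (card W) (card (A - W))"
  define q where "q = max (card W) (card (A - W))"
  have pq: "p * q = card W * card (A - W)" "p + q = Suc (2 * m)" "2 \<le> p" "p \<le> q"
    using cardWA w2 u2 by (auto simp: p_def q_def min_def max_def)
  have "card (X' c) \<le> p" "card (X' j) \<le> p" using X'W X'U by (auto simp: p_def)
  then have "p * q \<le> (2 * m - 2) + 2 * p" using cX SX cross pq(1) by simp
  then have "p * q + 3 \<le> 3 * p + q" using pq(2) m_ge_2 by simp
  then have "int p * int q + 3 \<le> 3 * int p + int q" by (metis of_nat_add of_nat_le_iff of_nat_mult of_nat_numeral)
  then have "(int p - 1) * (int q - 3) \<le> 0" by (simp add: algebra_simps)
  then have "q \<le> 3" using pq(3) by (auto simp: mult_le_0_iff)
  moreover have "odd (p + q)" using pq(2) by simp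
  ultimately have "q = 3" "p = 2" using pq(3,4)
    by (cases "q = 2"; cases "p = 2"; cases "q = 3"; auto)+
  then have m: "m = 2" and prod: "card W * card (A - W) = 6" using pq by auto
  have "card W = 2 \<and> card (A - W) = 3 \<or> card W = 3 \<and> card (A - W) = 2"
    using \<open>q = 3\<close> \<open>p = 2\<close> by (auto simp: p_def q_def min_def max_def split: if_splits)
  then show False
  proof
    \<comment> \<open>Colour \<open>c\<close> misses \<open>v\<close>, so its edges leaving
      \<open>W\<close> use the only other vertex of \<open>W\<close>. At most five edges leave
      \<open>W\<close>, instead of six.\<close>
    assume w: "card W = 2 \<and> card (A - W) = 3"
    have "card (X' c) \<le> card (W - {v})"
    proof (rule class_card_le)
      fix e assume e: "e \<in> X' c"
      then have "v \<notin> inc e" using \<open>v \<notin> V c\<close> by (auto simp: X'_def V_def)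
      then show "inc e \<inter> (W - {v}) \<noteq> {}" using e by (auto simp: X'_def X_def)
    qed (use finW in \<open>auto simp: X'_def\<close>)
    then have "card (X' c) \<le> 1" using w vW finW by simp
    moreover have "card (X' j) \<le> 2" using X'W[of j] w by simp
    ultimately show False using cX SX cross prod m by simp
  next
    \<comment> \<open>Now every bound is attained: \<open>S\<close> and the classes of
      \<open>c\<close> and \<open>j\<close> consist of edges leaving \<open>W\<close>, so no element
      of \<open>T\<close> lies inside \<open>W\<close>. Those at \<open>v\<close> end in the two
      outer vertices, so the maximal degree is at most two.\<close>
    assume w: "card W = 3 \<and> card (A - W) = 2"
    have le2: "card (X' t) \<le> 2" for t using X'U[of t] w by simp
    have "card (S \<inter> X) = 2" "card (X' c) = 2" "card (X' j) = 2"
      using cX SX cross prod m le2[of c] le2[of j] by linarith+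
    then have SX': "S \<subseteq> X" and cX': "colour_class c \<subseteq> X" and jX': "colour_class j \<subseteq> X"
      using cardS m card_class[OF c(1)] card_class[OF j(1)] finS finite_colour_class
        card_subset_eq[of S "S \<inter> X"] card_subset_eq[of "colour_class c" "X' c"]
        card_subset_eq[of "colour_class j" "X' j"]
      by (auto simp: X'_def)
    have not_inside: "card (inc t \<inter> W) \<le> 1" if t: "t \<in> T" for t
    proof -
      have "t \<in> X \<or> inc t \<inter> W = {}"
        using K_S[of t] SX' cX' jX' T_in_class[OF t] t by (auto simp: K_def)
      then have "inc t \<inter> W \<subset> inc t"
        using card_inc[of t] T_subset t by (auto simp: X_def)
      then have "card (inc t \<inter> W) < card (inc t)"
        using finite_inc[of t] T_subset t by (intro psubset_card_mono) auto
      then show ?thesis using card_inc[of t] T_subset t by auto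
    qed
    have "card {t \<in> T. v \<in> inc t} \<le> card (A - W)"
    proof -
      have "\<exists>z. z \<in> A - W \<and> inc t = {v, z}" if t: "t \<in> T" "v \<in> inc t" for t
      proof -
        have tE: "t \<in> E" using t T_subset by blast
        obtain z where z: "z \<noteq> v" "inc t = {v, z}" using other_end[OF tE t(2)] .
        have "z \<notin> W"
        proof
          assume "z \<in> W"
          then have "inc t \<inter> W = {v, z}" using z vW by auto
          then show False using not_inside[OF t(1)] z(1) by simp
        qed
        then show ?thesis using z inc_subset[OF tE] by auto
      qed
      then obtain z where z: "\<And>t. t \<in> T \<Longrightarrow> v \<in> inc t \<Longrightarrow> z t \<in> A - W \<and> inc t = {v, z t}"
        by metis
      have "inj_on z {t \<in> T. v \<in> inc t}"
      proof (rule inj_onI)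
        fix s t assume "s \<in> {t \<in> T. v \<in> inc t}" "t \<in> {t \<in> T. v \<in> inc t}" "z s = z t"
        then have "inc s = inc t" "s \<in> E" "t \<in> E" using z[of s] z[of t] T_subset by auto
        then show "s = t" using inj_inc by (auto dest: inj_onD)
      qed
      then show ?thesis
        using z finite_A by (intro card_inj_on_le[of z]) auto
    qed
    then have deg2: "deg u \<le> 2" if "u \<in> A" for u
      using v(2)[OF that] w by (simp add: deg_def)
    \<comment> \<open>The five edges of \<open>T\<close> have ten ends, but at most five inside
      \<open>W\<close> and at most four outside.\<close>
    have "(\<Sum>u\<in>A. deg u) = (\<Sum>t\<in>T. 2)"
      unfolding sum_deg[OF finite_A]
      using card_inc inc_subset T_subset by (intro sum.cong refl) (metis Int_absorb2 subsetD)
    then have "(\<Sum>u\<in>A. deg u) = 10" using card_T m by simp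
    moreover have "(\<Sum>u\<in>A. deg u) = (\<Sum>u\<in>A - W. deg u) + (\<Sum>u\<in>W. deg u)"
      using finite_A WA by (simp add: sum.subset_diff)
    moreover have "(\<Sum>u\<in>W. deg u) \<le> 5"
    proof -
      have "(\<Sum>u\<in>W. deg u) \<le> (\<Sum>t\<in>T. 1)"
        unfolding sum_deg[OF finW] using not_inside by (intro sum_mono) auto
      then show ?thesis using card_T m by simp
    qed
    moreover have "(\<Sum>u\<in>A - W. deg u) \<le> 4"
    proof -
      have "(\<Sum>u\<in>A - W. deg u) \<le> (\<Sum>u\<in>A - W. 2)"
        using deg2 by (intro sum_mono) auto
      then show ?thesis using w by simp
    qed
    ultimately show False by simp
  qed
qed

text \<open>
  The hub \<open>v\<close> lies on the element \<open>j\<close> of \<open>T\<close> and is missed by the colour \<open>c\<close>. The edges of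
  colours \<open>c\<close> and \<open>j\<close> form a path starting at \<open>v\<close> with \<open>j\<close>; without \<open>j\<close> it still
  visits every vertex except \<open>v\<close>. The other elements of \<open>T\<close> are linked to \<open>v\<close> in the
  remaining colours.
\<close>

lemma rooted_minor_exists: "\<exists>B. rooted_minor inc E T B"
proof -
  have "A \<noteq> {}" using card_A by auto
  then have "Max (deg ` A) \<in> deg ` A" using finite_A by (intro Max_in) auto
  then obtain v where "v \<in> A" and max: "Max (deg ` A) = deg v" by (rule imageE)
  then have v: "v \<in> A" "\<And>u. u \<in> A \<Longrightarrow> deg u \<le> deg v"
    using finite_A unfolding max[symmetric] by simp_all
  obtain c where c: "c \<in> T" "x c = v" using bij_x v(1) by (auto simp: bij_betw_def)
  have "inc c \<subseteq> A" "card (inc c) = 2" using c T_subset inc_subset card_inc by blast+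
  moreover from this have "inc c \<noteq> {}" by auto
  ultimately obtain u where u: "u \<in> inc c" "u \<in> A" by blast
  \<comment> \<open>An end of the edge \<open>c\<close> has positive degree, so by maximality some
    \<open>j \<in> T\<close> lies at \<open>v\<close>.\<close>
  have "deg u \<noteq> 0" using u(1) c(1) finite_T by (auto simp: deg_def)
  then have "deg v \<noteq> 0" using v(2)[OF u(2)] by simp
  then have "{t \<in> T. v \<in> inc t} \<noteq> {}" unfolding deg_def by (metis card.empty)
  then obtain j where j: "j \<in> T" "v \<in> inc j" by blast
  have vc: "v \<notin> V c" using V_eq[OF c(1)] c(2) by simp
  moreover have "v \<in> V j" using T_in_class[OF j(1)] j(2) by (auto simp: V_def)
  ultimately have cj: "c \<noteq> j" by auto
  define K where "K = T - {c, j}"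
  define E' where "E' = {e \<in> E. col e \<in> K}"
  have jE: "j \<in> E" "col j = j" using j T_subset col_T by auto
  obtain w where w: "w \<noteq> v" "inc j = {v, w}" using other_end[OF jE(1) j(2)] .
  show ?thesis
  proof (rule linking[of E' K "{e \<in> E'. v \<in> inc e}" inc])
    show "finite E'" using finite_E by (simp add: E'_def)
    show "K \<subseteq> E'" using T_subset col_T by (auto simp: E'_def K_def)
    show "{e \<in> E'. v \<in> inc e} \<subseteq> E'" by blast
  next
    fix S R
    assume "S \<subseteq> E'" "card S < card K" "R \<subseteq> E' - S" "{e \<in> E'. v \<in> inc e} \<subseteq> R \<union> S" "K \<inter> R = {}"
      "\<And>e f. e \<in> R \<Longrightarrow> f \<in> E' - S \<Longrightarrow> inc e \<inter> inc f \<noteq> {} \<Longrightarrow> f \<in> R"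
    then show ?thesis using no_separator[OF v c j K_def E'_def] by blast
  next
    fix P
    assume P: "\<And>t. t \<in> K \<Longrightarrow> t \<in> P t \<and> P t \<subseteq> E' \<and> edge_connected inc (P t) \<and> P t \<inter> {e \<in> E'. v \<in> inc e} \<noteq> {}"
      and Pdisj: "\<And>s t. s \<in> K \<Longrightarrow> t \<in> K \<Longrightarrow> s \<noteq> t \<Longrightarrow> P s \<inter> P t = {}"
    define Q where "Q = {e \<in> E. col e = c \<or> col e = j} - {j}"
    have cQ: "c \<in> Q" using c T_subset col_T cj by (auto simp: Q_def)
    \<comment> \<open>An edge of \<open>Q\<close> meeting \<open>j\<close> has colour
      \<open>c\<close>, which misses \<open>v\<close>, so it passes through \<open>w\<close> and is
      unique. Hence removing \<open>j\<close> does not disconnect the Kempe chain.\<close>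
    have end_j: "f = g" if "f \<in> Q" "g \<in> Q" "inc f \<inter> inc j \<noteq> {}" "inc g \<inter> inc j \<noteq> {}" for f g
    proof -
      have *: "col h = c \<and> w \<in> inc h" if h: "h \<in> Q" "inc h \<inter> inc j \<noteq> {}" for h
      proof -
        have "col h = c" using h proper[of h j] jE by (auto simp: Q_def)
        moreover have "v \<notin> inc h" using vc h \<open>col h = c\<close> by (auto simp: V_def colour_class_def Q_def)
        ultimately show ?thesis using h w by auto
      qed
      show ?thesis
        using *[OF that(1,3)] *[OF that(2,4)] proper[of f g] that by (auto simp: Q_def)
    qed
    have Qconn: "edge_connected inc Q"
    proof (rule edge_connectedI)
      fix C assume C: "C \<subseteq> Q" "C \<noteq> {}"
        and cl: "\<And>e f. e \<in> C \<Longrightarrow> f \<in> Q \<Longrightarrow> inc e \<inter> inc f \<noteq> {} \<Longrightarrow> f \<in> C"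
      obtain z where z: "z \<in> C" using C by blast
      define D where "D = C \<union> (if \<exists>g\<in>C. inc g \<inter> inc j \<noteq> {} then {j} else {})"
      show "Q \<subseteq> C"
      proof
        fix h assume h: "h \<in> Q"
        have "h \<in> D"
        proof (rule kempe_class_subset[OF c(1) j(1) cj, where x = z])
          fix e f assume *: "e \<in> D" "f \<in> E" "col f = c \<or> col f = j" "inc e \<inter> inc f \<noteq> {}"
          show "f \<in> D"
          proof (cases "e \<in> C")
            case True
            then show ?thesis
              using cl[of e f] * by (cases "f = j") (auto simp: D_def Q_def)
          next
            case False
            then have e: "e = j" and "\<exists>g\<in>C. inc g \<inter> inc j \<noteq> {}"
              using * by (auto simp: D_def split: if_splits)
            then obtain g where g: "g \<in> C" "inc g \<inter> inc j \<noteq> {}" by blast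
            show ?thesis
            proof (cases "f = j")
              case True
              then show ?thesis using * e by simp
            next
              case False
              then have "f = g" using end_j[of f g] * e g C by (auto simp: Q_def)
              then show ?thesis using g by (simp add: D_def)
            qed
          qed
        qed (use z C h in \<open>auto simp: D_def Q_def\<close>)
        then show "h \<in> C" using h by (auto simp: D_def Q_def split: if_splits)
      qed
    qed
    \<comment> \<open>Colour \<open>c\<close> misses only \<open>v\<close>, so it covers the other
      end of any edge at \<open>v\<close>.\<close>
    have Q_meets: "\<exists>h\<in>Q. inc e \<inter> inc h \<noteq> {}" if e: "e \<in> E" "v \<in> inc e" for e
    proof -
      obtain z where z: "z \<in> inc e" "z \<noteq> v"
        using other_end[OF e] by blast
      then have "z \<in> V c" using V_eq[OF c(1)] c(2) inc_subset[OF e(1)] by auto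
      then obtain h where "h \<in> E" "col h = c" "z \<in> inc h" by (auto simp: V_def colour_class_def)
      then show ?thesis using z cj jE by (auto simp: Q_def intro!: bexI[of _ h])
    qed
    define B where "B t = (if t = j then {j} else if t = c then Q else P t)" for t
    have BK: "B t = P t" if "t \<in> K" for t using that by (auto simp: B_def K_def)
    have Bj: "B j = {j}" and Bc: "B c = Q" using cj by (auto simp: B_def)
    have T_cases: "t = j \<or> t = c \<or> t \<in> K" if "t \<in> T" for t using that by (auto simp: K_def)
    have E'E: "E' \<subseteq> E" and E'Q: "E' \<inter> Q = {}" and E'j: "j \<notin> E'"
      using jE by (auto simp: E'_def Q_def K_def)
    have at_v: "\<exists>e\<in>B t. e \<in> E \<and> v \<in> inc e" if "t \<in> T" "t \<noteq> c" for t
    proof (cases "t = j")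
      case True
      then show ?thesis using Bj jE j by auto
    next
      case False
      then have "t \<in> K" using that by (auto simp: K_def)
      then show ?thesis using P[of t] BK[of t] E'E by auto
    qed
    have 1: "t \<in> B t \<and> B t \<subseteq> E \<and> edge_connected inc (B t)" if t: "t \<in> T" for t
      using T_cases[OF t]
    proof (elim disjE)
      assume "t \<in> K"
      then show ?thesis using P[of t] BK[of t] E'E by auto
    next
      assume "t = j"
      then show ?thesis using Bj jE edge_connected_singleton by simp
    next
      assume "t = c"
      moreover have "Q \<subseteq> E" by (auto simp: Q_def)
      ultimately show ?thesis using Bc cQ Qconn by simp
    qed
    have 2: "B s \<inter> B t = {}" if st: "s \<in> T" "t \<in> T" "s \<noteq> t" for s t
    proof -
      have Kj: "B t \<inter> {j} = {}" and KQ: "B t \<inter> Q = {}" if "t \<in> K" for t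
        using P[OF that] BK[OF that] E'Q E'j by auto
      have "j \<notin> Q" by (simp add: Q_def)
      then show ?thesis
        using T_cases[OF st(1)] T_cases[OF st(2)] st(3) Kj[of s] Kj[of t] KQ[of s] KQ[of t]
          Pdisj[of s t] BK Bj Bc by auto
    qed
    have 3: "\<exists>e\<in>B s. \<exists>f\<in>B t. inc e \<inter> inc f \<noteq> {}" if st: "s \<in> T" "t \<in> T" "s \<noteq> t" for s t
    proof (cases "s = c")
      case True
      then obtain e where e: "e \<in> B t" "e \<in> E" "v \<in> inc e" using at_v[OF st(2)] st(3) by blast
      then show ?thesis using Q_meets[OF e(2,3)] True Bc by blast
    next
      case s: False
      then obtain e where e: "e \<in> B s" "e \<in> E" "v \<in> inc e" using at_v[OF st(1)] by blast
      show ?thesis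
      proof (cases "t = c")
        case True
        then show ?thesis using Q_meets[OF e(2,3)] e(1) Bc by blast
      next
        case False
        then obtain f where "f \<in> B t" "v \<in> inc f" using at_v[OF st(2)] by blast
        then show ?thesis using e by blast
      qed
    qed
    have "rooted_minor inc E T B" using 1 2 3 by (simp add: rooted_minor_def)
    then show ?thesis by blast
  qed
qed

end

section \<open>Line graphs\<close>

text \<open>All classes have the same size \<open>m\<close>. For \<open>m = 1\<close> the set
  \<open>V t\<close> consists of the ends of \<open>t\<close>, and \<open>edge_meets_V\<close> makes
  the elements of \<open>T\<close> meet. For larger \<open>m\<close>, counting yields a
  \<open>near_factorization\<close>.\<close>

lemma (in kempe_graph) no_full_vertex:
  assumes nofull: "\<And>v. \<exists>t\<in>T. v \<notin> V t"
  shows "\<exists>B. rooted_minor inc E T B"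
proof -
  obtain t0 where t0: "t0 \<in> T" using nofull by blast
  define m where "m = card (colour_class t0)"
  have card_cc: "card (colour_class t) = m" if "t \<in> T" for t
    using card_V_eq[OF nofull that t0] by (simp add: card_V m_def)
  have "m \<noteq> 0" using card_V_ge_2[OF t0] by (simp add: card_V m_def)
  show ?thesis
  proof (cases "m = 1")
    case True
    have V: "V t = inc t" if t: "t \<in> T" for t
    proof -
      have "colour_class t = {t}"
        using card_cc[OF t] True T_in_class[OF t] by (metis card_1_singletonE singletonD)
      then show ?thesis by (simp add: V_def)
    qed
    have "inc s \<inter> inc t \<noteq> {}" if "s \<in> T" "t \<in> T" "s \<noteq> t" for s t
      using edge_meets_V[OF that(2,1) that(3)[symmetric] T_in_class[OF that(1)]] V[OF that(2)] by simp
    then have "rooted_minor inc E T (\<lambda>t. {t})"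
      using T_subset by (auto simp: rooted_minor_def edge_connected_singleton)
    then show ?thesis by blast
  next
    case False
    then have m: "2 \<le> m" using \<open>m \<noteq> 0\<close> by simp
    obtain A where A: "finite A" "\<And>t. t \<in> T \<Longrightarrow> \<exists>y\<in>A. V t = A - {y}"
      using V_eq_Diff_singleton[OF nofull] by blast
    then obtain x where x: "\<And>t. t \<in> T \<Longrightarrow> x t \<in> A \<and> V t = A - {x t}" by metis
    have card_A: "card A = Suc (2 * m)"
    proof -
      have "card (A - {x t0}) = 2 * m" using x[OF t0] card_V[of t0] by (simp add: m_def)
      moreover have "Suc (card (A - {x t0})) = card A"
        using x[OF t0] A(1) by (intro card_Suc_Diff1) auto
      ultimately show ?thesis by metis
    qed
    \<comment> \<open>Every vertex is missed by some colour, so there are at least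
      \<open>card A\<close> colours.\<close>
    have surj: "x ` T = A"
    proof
      show "A \<subseteq> x ` T"
      proof
        fix a assume a: "a \<in> A"
        obtain t where "t \<in> T" "a \<notin> V t" using nofull by blast
        then show "a \<in> x ` T" using x[of t] a by auto
      qed
    qed (use x in auto)
    have inj: "inj_on inc E"
    proof (rule inj_onI, rule ccontr)
      fix e f assume ef: "e \<in> E" "f \<in> E" "inc e = inc f" "e \<noteq> f"
      have "inc e \<noteq> {}" using card_inc[OF ef(1)] by auto
      then have ne: "col e \<noteq> col f" using proper[of e f] ef by auto
      \<comment> \<open>Whatever meets one of two parallel edges meets the other, so together they
        are a whole Kempe chain, and their classes are too small.\<close>
      have "colour_class (col e) \<subseteq> {e}"
      proof
        fix h assume h: "h \<in> colour_class (col e)"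
        have "h \<in> {e, f}"
        proof (rule kempe_class_subset[OF col_in_T[OF ef(1)] col_in_T[OF ef(2)] ne, where x = e])
          fix a b assume *: "a \<in> {e, f}" "b \<in> E" "col b = col e \<or> col b = col f" "inc a \<inter> inc b \<noteq> {}"
          then have "inc e \<inter> inc b \<noteq> {}" "inc f \<inter> inc b \<noteq> {}" using ef(3) by auto
          then show "b \<in> {e, f}" using proper[of e b] proper[of f b] ef * by auto
        qed (use ef h in \<open>auto simp: colour_class_def\<close>)
        then show "h \<in> {e}" using h ne by (auto simp: colour_class_def)
      qed
      then have "card (colour_class (col e)) \<le> 1" using card_mono[of "{e}"] by fastforce
      then show False using card_cc[OF col_in_T[OF ef(1)]] m by simp
    qed
    have sub: "inc ` E \<subseteq> {X. X \<subseteq> A \<and> card X = 2}"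
    proof -
      have "inc e \<subseteq> A" if "e \<in> E" for e
      proof -
        have "inc e \<subseteq> V (col e)" using that by (auto simp: V_def colour_class_def)
        then show ?thesis using x[OF col_in_T[OF that]] by auto
      qed
      then show ?thesis using card_inc by auto
    qed
    have card_pairs: "card {X. X \<subseteq> A \<and> card X = 2} = Suc (2 * m) * m"
      using n_subsets[OF A(1), of 2] card_A by (simp add: choose_two)
    have fin_pairs: "finite {X. X \<subseteq> A \<and> card X = 2}" using A(1) by simp
    have "E = (\<Union>t\<in>T. colour_class t)" using col_in_T by (auto simp: colour_class_def)
    also have "card \<dots> = (\<Sum>t\<in>T. card (colour_class t))"
      using finite_T finite_colour_class by (intro card_UN_disjoint) (auto simp: colour_class_def)
    finally have card_E: "card E = card T * m" using card_cc by simp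
    \<comment> \<open>The edges are distinct pairs, which gives \<open>card T \<le> card A\<close>.
      With \<open>surj\<close> this becomes an equality, so \<open>x\<close> is bijective and every
      pair is an edge.\<close>
    have "card E \<le> Suc (2 * m) * m"
      using card_mono[OF fin_pairs sub] card_pairs inj by (simp add: card_image)
    then have "card T * m \<le> card A * m" using card_E card_A by metis
    then have "card T \<le> card A" using m by simp
    moreover have "card A \<le> card T" using surj finite_T card_image_le by blast
    ultimately have card_T: "card T = card A" by simp
    have "inj_on x T" using surj card_T finite_T by (intro eq_card_imp_inj_on) auto
    then have bij: "bij_betw x T A" using surj by (simp add: bij_betw_def)
    have image: "inc ` E = {X. X \<subseteq> A \<and> card X = 2}"
      using card_image[OF inj] card_E card_T card_A card_pairs
      by (intro card_subset_eq[OF fin_pairs sub]) simp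
    interpret near_factorization E inc col T A x m
      by unfold_locales (use A(1) card_A m x bij inj image in auto)
    show ?thesis by (rule rooted_minor_exists)
  qed
qed

text \<open>The induction generalizes \<open>inc\<close>, because contraction changes the ends of
  the edges; \<open>col\<close>, \<open>T\<close> and the vertex type stay fixed.\<close>

theorem kempe_graph_rooted_minor:
  assumes "kempe_graph E inc col T"
  shows "\<exists>B. rooted_minor inc E T B"
  using assms
proof (induction "card E" arbitrary: E inc rule: less_induct)
  case less
  interpret kempe_graph E inc col T by fact
  show ?case
  proof (cases "\<exists>v. \<forall>t\<in>T. covered t v")
    case True
    then obtain v where "\<And>t. t \<in> T \<Longrightarrow> covered t v" by blast
    then show ?thesis by (rule full_vertex_step[OF _ less.hyps])
  next
    case False
    then show ?thesis using no_full_vertex by (simp add: covered_iff)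
  qed
qed

section \<open>Translation to the line graph\<close>

lemma verts_line_graph: "verts (with_proj (line_graph H)) = edges H"
  by (simp add: line_graph_def)

lemma dominates_line_graph:
  "e \<rightarrow>\<^bsub>with_proj (line_graph H)\<^esub> f \<longleftrightarrow>
     e \<in> edges H \<and> f \<in> edges H \<and> e \<noteq> f \<and> ends H e \<inter> ends H f \<noteq> {}"
  by (simp add: line_graph_def)

text \<open>The edges reachable from a given one form a closed set, and a closed set contains
  whatever is reachable from it. Nonemptiness is stated separately because
  \<open>edge_connected\<close> holds for the empty set.\<close>

lemma connected_set_line_graph:
  "connected_set (with_proj (line_graph H)) X \<longleftrightarrow>
     X \<subseteq> edges H \<and> X \<noteq> {} \<and> edge_connected (ends H) X"
proof -
  let ?G = "with_proj (line_graph H) \<restriction> X"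
  define A where "A = {(e, f). e \<in> X \<and> f \<in> X \<and> e \<noteq> f \<and> ends H e \<inter> ends H f \<noteq> {}}"
  have main: "Digraph_Component.connected ?G \<longleftrightarrow> X \<noteq> {} \<and> edge_connected (ends H) X"
    if X: "X \<subseteq> edges H"
  proof -
    have ends: "arcs_ends ?G = A"
      using X by (auto simp: A_def arcs_ends_def arc_to_ends_def induce_subgraph_def line_graph_def image_iff)
    have "A\<^sup>s = A" by (auto simp: symcl_def A_def)
    then have conv: "Digraph_Component.connected ?G \<longleftrightarrow> X \<noteq> {} \<and> (\<forall>u\<in>X. \<forall>w\<in>X. (u, w) \<in> rtrancl_on X A)"
      by (simp add: connected_conv ends)
    have "(\<forall>u\<in>X. \<forall>w\<in>X. (u, w) \<in> rtrancl_on X A) \<longleftrightarrow> edge_connected (ends H) X"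
    proof
      assume reach: "\<forall>u\<in>X. \<forall>w\<in>X. (u, w) \<in> rtrancl_on X A"
      show "edge_connected (ends H) X"
      proof (rule edge_connectedI)
        fix C assume C: "C \<subseteq> X" "C \<noteq> {}"
          and cl: "\<And>e f. e \<in> C \<Longrightarrow> f \<in> X \<Longrightarrow> ends H e \<inter> ends H f \<noteq> {} \<Longrightarrow> f \<in> C"
        obtain u where u: "u \<in> C" using C by blast
        show "X \<subseteq> C"
        proof
          fix w assume "w \<in> X"
          then have "(u, w) \<in> rtrancl_on X A" using reach u C by blast
          then show "w \<in> C" by (induction rule: rtrancl_on_induct) (use u cl in \<open>auto simp: A_def\<close>)
        qed
      qed
    next
      assume conn: "edge_connected (ends H) X"
      show "\<forall>u\<in>X. \<forall>w\<in>X. (u, w) \<in> rtrancl_on X A"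
      proof (intro ballI)
        fix u w assume u: "u \<in> X" and w: "w \<in> X"
        have "w \<in> {w. (u, w) \<in> rtrancl_on X A}"
        proof (rule edge_connectedD[OF conn u _ w])
          fix e f assume "e \<in> {w. (u, w) \<in> rtrancl_on X A}" "e \<in> X" "f \<in> X" "ends H e \<inter> ends H f \<noteq> {}"
          then show "f \<in> {w. (u, w) \<in> rtrancl_on X A}"
            by (cases "e = f") (auto simp: A_def intro: rtrancl_on_into_rtrancl_on)
        qed (use u in simp)
        then show "(u, w) \<in> rtrancl_on X A" by simp
      qed
    qed
    then show ?thesis using conv by simp
  qed
  then show ?thesis unfolding connected_set_def verts_line_graph by blast
qed

theorem theorem1:
  fixes H :: "('v, 'e) multigraph" and \<CC> :: "'e set set" and T :: "'e set"
  assumes "loopless_multigraph H"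
    and "kempe_coloring (with_proj (line_graph H)) \<CC>"
    and "transversal \<CC> T"
  shows "\<exists>\<BB>. clique_minor (with_proj (line_graph H)) \<BB> \<and> transversal \<BB> T"
proof -
  interpret loopless_multigraph H by fact
  let ?G = "with_proj (line_graph H)"
  have part: "partition_on (edges H) \<CC>" and anti: "\<And>A. A \<in> \<CC> \<Longrightarrow> anticlique ?G A"
    and conn: "\<And>A A'. A \<in> \<CC> \<Longrightarrow> A' \<in> \<CC> \<Longrightarrow> A \<noteq> A' \<Longrightarrow> connected_set ?G (A \<union> A')"
    using assms(2) unfolding kempe_coloring_def coloring_def pairwise_def verts_line_graph by blast+
  have T: "T \<subseteq> \<Union> \<CC>" "\<And>A. A \<in> \<CC> \<Longrightarrow> card (T \<inter> A) = 1"
    using assms(3) by (auto simp: transversal_def)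
  have E: "edges H = \<Union> \<CC>" using part by (simp add: partition_on_def)
  have "\<exists>t. \<exists>A\<in>\<CC>. e \<in> A \<and> T \<inter> A = {t}" if "e \<in> edges H" for e
    using that T(2) unfolding E by (metis UnionE card_1_singletonE)
  \<comment> \<open>Each class is named by its unique element of \<open>T\<close>, as
    \<open>kempe_graph\<close> requires.\<close>
  then obtain col where col: "\<And>e. e \<in> edges H \<Longrightarrow> \<exists>A\<in>\<CC>. e \<in> A \<and> T \<inter> A = {col e}" by metis
  have uniq: "A = A'" if "A \<in> \<CC>" "A' \<in> \<CC>" "z \<in> A" "z \<in> A'" for A A' z
    using part that by (meson disjoint_iff disjointD partition_onD2)
  have col_eq: "col e = t" if "A \<in> \<CC>" "e \<in> A" "t \<in> T \<inter> A" for A e t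
  proof -
    have "e \<in> edges H" using that E by blast
    then obtain A' where "A' \<in> \<CC>" "e \<in> A'" "T \<inter> A' = {col e}" using col by blast
    then show ?thesis using uniq[of A A' e] that by auto
  qed
  have col_class: "{e \<in> edges H. col e = t} = A" if A: "A \<in> \<CC>" "t \<in> T \<inter> A" for A t
  proof
    show "A \<subseteq> {e \<in> edges H. col e = t}" using col_eq[OF A(1) _ A(2)] A(1) E by blast
    show "{e \<in> edges H. col e = t} \<subseteq> A"
    proof
      fix e assume "e \<in> {e \<in> edges H. col e = t}"
      then obtain A' where "A' \<in> \<CC>" "e \<in> A'" "t \<in> A'" using col[of e] by blast
      then show "e \<in> A" using uniq[of A A' t] A by blast
    qed
  qed
  have "kempe_graph (edges H) (ends H) col T"
  proof
    fix e f assume ef: "e \<in> edges H" "f \<in> edges H" "e \<noteq> f" "col e = col f"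
    obtain A where A: "A \<in> \<CC>" "e \<in> A" "T \<inter> A = {col e}" using col[OF ef(1)] by blast
    have "f \<in> {e' \<in> edges H. col e' = col e}" using ef by simp
    also have "\<dots> = A" by (rule col_class[OF A(1)]) (simp add: A(3))
    finally have "\<not> e \<rightarrow>\<^bsub>?G\<^esub> f"
      using anti[OF A(1)] A(2) ef(3) unfolding anticlique_def pairwise_def by blast
    then show "ends H e \<inter> ends H f = {}" using ef unfolding dominates_line_graph by blast
  next
    fix s t assume st: "s \<in> T" "t \<in> T" "s \<noteq> t"
    obtain A A' where A: "A \<in> \<CC>" "s \<in> A" "A' \<in> \<CC>" "t \<in> A'" using st T(1) by blast
    have cs: "{e \<in> edges H. col e = s} = A" "{e \<in> edges H. col e = t} = A'"
      using col_class A st by blast+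
    have "A \<noteq> A'"
    proof
      assume "A = A'"
      then have "col s = s" "col s = t" using col_eq A st by blast+
      then show False using st by simp
    qed
    then have "connected_set ?G (A \<union> A')" by (rule conn[OF A(1,3)])
    then have "edge_connected (ends H) (A \<union> A')" unfolding connected_set_line_graph by simp
    moreover have "{e \<in> edges H. col e = s \<or> col e = t} = A \<union> A'" using cs by blast
    ultimately show "edge_connected (ends H) {e \<in> edges H. col e = s \<or> col e = t}" by simp
  next
    fix t assume "t \<in> T"
    then show "col t = t" using col_eq T(1) by blast
  next
    fix e assume "e \<in> edges H"
    then show "col e \<in> T" using col[of e] by blast
  qed (use finite_edges card_ends T(1) E in auto)
  then obtain B where "rooted_minor (ends H) (edges H) T B"
    using kempe_graph_rooted_minor by blast
  then have B: "\<And>t. t \<in> T \<Longrightarrow> t \<in> B t \<and> B t \<subseteq> edges H \<and> edge_connected (ends H) (B t)"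
    and disj: "\<And>s t. s \<in> T \<Longrightarrow> t \<in> T \<Longrightarrow> s \<noteq> t \<Longrightarrow> B s \<inter> B t = {}"
    and meet: "\<And>s t. s \<in> T \<Longrightarrow> t \<in> T \<Longrightarrow> s \<noteq> t \<Longrightarrow> \<exists>e\<in>B s. \<exists>f\<in>B t. ends H e \<inter> ends H f \<noteq> {}"
    unfolding rooted_minor_def by blast+
  have "adjacent_sets ?G (B s) (B t)" if st: "s \<in> T" "t \<in> T" "s \<noteq> t" for s t
  proof -
    obtain e f where ef: "e \<in> B s" "f \<in> B t" "ends H e \<inter> ends H f \<noteq> {}" using meet[OF st] by blast
    \<comment> \<open>Disjointness of the branching sets makes the two incident edges distinct,
      hence adjacent in the line graph.\<close>
    then have "e \<rightarrow>\<^bsub>?G\<^esub> f"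
      unfolding dominates_line_graph using disj[OF st] B[OF st(1)] B[OF st(2)] by blast
    then show ?thesis using ef unfolding adjacent_sets_def by blast
  qed
  then have "pairwise (adjacent_sets ?G) (B ` T)" by (auto simp: pairwise_def)
  moreover have "disjoint (B ` T)" using disj by (fastforce simp: disjoint_def)
  moreover have "A \<noteq> {} \<and> connected_set ?G A" if "A \<in> B ` T" for A
    using that B by (auto simp: connected_set_line_graph)
  ultimately have "clique_minor ?G (B ` T)" by (simp add: clique_minor_def)
  moreover have "transversal (B ` T) T"
  proof -
    have "T \<inter> B t = {t}" if "t \<in> T" for t
      using B disj that by blast
    then show ?thesis using B by (auto simp: transversal_def)
  qed
  ultimately show ?thesis by blast
qed

end
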